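(* The Farey graph $F$ is a typical $\Pi$-graph, and every typical $\Pi$-graph is minor-equivalent to $F$. In other words, up to minor-equivalence, the Farey graph is the unique typical $\Pi$-graph.
   Context: Graphs are simple and may be infinite. The Farey graph $F$ is the graph with vertex set $\mathbb{Q}\cup\{\infty\}$ in which two rationals $a/b$ and $c/d$ written in lowest terms (allowing $\infty=(\pm1)/0$) are adjacent if and only if $ad-bc=\pm1$; any graph isomorphic to it is also called the Farey graph. A graph is infinitely edge-connected if it has at least two vertices and $G-E'$ is connected for every finite set $E'$ of edges. Paths are independent if they are internally vertex-disjoint. A $\Pi$-graph is an infinitely edge-connected graph that does not contain infinitely many independent paths between any two of its vertices. A graph $H$ is a minor of $G$ if there are pairwise disjoint non-empty vertex sets $V_h\subseteq V(G)$ ($h\in V(H)$), each inducing a connected subgraph of $G$ (the branch sets), such that for every edge $hh'$ of $H$ there is an edge of $G$ between $V_h$ and $V_{h'}$. A $\Pi$-graph is typical if it occurs as a minor in every $\Pi$-graph. Two graphs are minor-equivalent if each is a minor of the other. *)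

theory Defs
  imports Complex_Main "HOL-Library.Infinite_Set"
begin

type_synonym 'a graph = "'a set \<times> 'a set set"

definition verts :: "'a graph \<Rightarrow> 'a set" where
  "verts G = fst G"

definition edges :: "'a graph \<Rightarrow> 'a set set" where
  "edges G = snd G"

definition wf_graph :: "'a graph \<Rightarrow> bool" where
  "wf_graph G \<longleftrightarrow> (\<forall>e\<in>edges G. \<exists>x y. x \<noteq> y \<and> x \<in> verts G \<and> y \<in> verts G \<and> e = {x, y})"

definition adj :: "'a graph \<Rightarrow> 'a \<Rightarrow> 'a \<Rightarrow> bool" where
  "adj G x y \<longleftrightarrow> x \<noteq> y \<and> {x, y} \<in> edges G"

definition is_path :: "'a graph \<Rightarrow> 'a list \<Rightarrow> bool" where
  "is_path G p \<longleftrightarrow> p \<noteq> [] \<and> distinct p \<and> set p \<subseteq> verts G \<and>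
     (\<forall>i. Suc i < length p \<longrightarrow> adj G (p ! i) (p ! Suc i))"

definition path_between :: "'a graph \<Rightarrow> 'a \<Rightarrow> 'a \<Rightarrow> 'a list \<Rightarrow> bool" where
  "path_between G x y p \<longleftrightarrow> is_path G p \<and> hd p = x \<and> last p = y"

definition inner_verts :: "'a list \<Rightarrow> 'a set" where
  "inner_verts p = set (butlast (tl p))"

definition graph_connected :: "'a graph \<Rightarrow> bool" where
  "graph_connected G \<longleftrightarrow> (\<forall>x\<in>verts G. \<forall>y\<in>verts G. \<exists>p. path_between G x y p)"

definition delete_edges :: "'a graph \<Rightarrow> 'a set set \<Rightarrow> 'a graph" where
  "delete_edges G F = (verts G, edges G - F)"

definition induced :: "'a graph \<Rightarrow> 'a set \<Rightarrow> 'a graph" where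
  "induced G X = (X, {e \<in> edges G. e \<subseteq> X})"

definition inf_edge_connected :: "'a graph \<Rightarrow> bool" where
  "inf_edge_connected G \<longleftrightarrow>
     (\<exists>x\<in>verts G. \<exists>y\<in>verts G. x \<noteq> y) \<and>
     (\<forall>F. finite F \<and> F \<subseteq> edges G \<longrightarrow> graph_connected (delete_edges G F))"

definition inf_indep_paths :: "'a graph \<Rightarrow> bool" where
  "inf_indep_paths G \<longleftrightarrow>
     (\<exists>x\<in>verts G. \<exists>y\<in>verts G. x \<noteq> y \<and>
        (\<exists>P. infinite P \<and> (\<forall>p\<in>P. path_between G x y p) \<and>
             (\<forall>p\<in>P. \<forall>q\<in>P. p \<noteq> q \<longrightarrow> inner_verts p \<inter> inner_verts q = {})))"

definition Pi_graph :: "'a graph \<Rightarrow> bool" where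
  "Pi_graph G \<longleftrightarrow> wf_graph G \<and> inf_edge_connected G \<and> \<not> inf_indep_paths G"

definition is_minor :: "'b graph \<Rightarrow> 'a graph \<Rightarrow> bool" where
  "is_minor H G \<longleftrightarrow>
     (\<exists>B :: 'b \<Rightarrow> 'a set.
        (\<forall>h\<in>verts H. B h \<noteq> {} \<and> B h \<subseteq> verts G \<and> graph_connected (induced G (B h))) \<and>
        (\<forall>h\<in>verts H. \<forall>h'\<in>verts H. h \<noteq> h' \<longrightarrow> B h \<inter> B h' = {}) \<and>
        (\<forall>h\<in>verts H. \<forall>h'\<in>verts H. adj H h h' \<longrightarrow>
            (\<exists>u\<in>B h. \<exists>v\<in>B h'. {u, v} \<in> edges G)))"

definition minor_equiv :: "'a graph \<Rightarrow> 'b graph \<Rightarrow> bool" where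
  "minor_equiv G H \<longleftrightarrow> is_minor G H \<and> is_minor H G"

definition typical_in :: "'c itself \<Rightarrow> 'b graph \<Rightarrow> bool" where
  "typical_in _ H \<longleftrightarrow> Pi_graph H \<and> (\<forall>G :: 'c graph. Pi_graph G \<longrightarrow> is_minor H G)"

text \<open>Farey graph on \<rat> \<union> {\<infinity>}, represented by rat option (None = \<infinity> = 1/0).\<close>
definition frac :: "rat option \<Rightarrow> int \<times> int" where
  "frac x = (case x of None \<Rightarrow> (1, 0) | Some q \<Rightarrow> quotient_of q)"

definition Farey :: "rat option graph" where
  "Farey = (UNIV, {{x, y} | x y. let (a, b) = frac x; (c, d) = frac y in
                                  \<bar>a * d - b * c\<bar> = 1})"

end

theory Submission
  imports Defs "HOL-Library.Countable"
begin

text \<open>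
  To find the Farey graph as a minor of a \<open>\<Pi>\<close>-graph, grow finite connected branch sets step by step.
  Suppose two finite connected sets \<open>U\<close> and \<open>V\<close> cannot be separated by finitely many edges inside
  \<open>U \<union> V \<union> X\<close>. First absorb a \<open>U\<close>-\<open>V\<close> path into \<open>U\<close> to make \<open>U\<close> and \<open>V\<close> adjacent. As there are
  no infinitely many independent paths, a finite \<open>S \<subseteq> X\<close> meets all remaining \<open>U\<close>-\<open>V\<close> paths through
  \<open>X\<close>. By the pigeonhole principle there are \<open>s, s' \<in> S\<close> that are the first and the last vertex in
  \<open>S\<close> of some \<open>U\<close>-\<open>V\<close> path however finitely many edges are forbidden; joining them by a path in
  \<open>X\<close> gives a new set \<open>W\<close>, which is infinitely edge-connected to \<open>U\<close> and to \<open>V\<close> through disjoint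
  parts of \<open>X\<close>. Iterating along the Stern-Brocot tree yields one half of the Farey graph, and
  merging the two end sets of the root (they are adjacent) yields both halves, glued along the edge
  from 0 to \<open>\<infinity>\<close>.

  The Farey graph itself is infinitely edge-connected because an edge can be replaced by the path
  through the nodes of any sufficiently deep level below it. Two of its vertices are not joined by
  infinitely many independent paths because an integer-valued quadratic form on the vertices has
  opposite signs at them, has finitely many zeros, and changes sign along no edge except possibly the
  one joining them.
\<close>

section \<open>Walks and connectedness\<close>

abbreviation adj_avoiding :: "'a graph \<Rightarrow> 'a set set \<Rightarrow> 'a \<Rightarrow> 'a \<Rightarrow> bool" where
  "adj_avoiding G F x y \<equiv> adj G x y \<and> {x, y} \<notin> F"

text \<open>Reflexive even at vertices outside \<open>A\<close>. This is why extracting a walk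
  inside \<open>A\<close> requires the start to lie in \<open>A\<close>.\<close>

definition reach_in :: "'a graph \<Rightarrow> 'a set \<Rightarrow> 'a \<Rightarrow> 'a \<Rightarrow> bool" where
  "reach_in G A = (\<lambda>x y. x \<in> A \<and> y \<in> A \<and> adj G x y)\<^sup>*\<^sup>*"

definition conn_in :: "'a graph \<Rightarrow> 'a set \<Rightarrow> bool" where
  "conn_in G A \<longleftrightarrow> (\<forall>x\<in>A. \<forall>y\<in>A. reach_in G A x y)"

lemma adj_sym: "adj G x y \<Longrightarrow> adj G y x"
  by (auto simp: adj_def insert_commute)

lemma is_path_iff: "is_path G p \<longleftrightarrow> p \<noteq> [] \<and> distinct p \<and> set p \<subseteq> verts G \<and> successively (adj G) p"
  by (simp add: is_path_def successively_conv_nth)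

lemma reach_in_refl [simp]: "reach_in G A x x"
  by (simp add: reach_in_def)

lemma reach_in_trans: "reach_in G A x y \<Longrightarrow> reach_in G A y z \<Longrightarrow> reach_in G A x z"
  by (simp add: reach_in_def)

lemma reach_in_step: "x \<in> A \<Longrightarrow> y \<in> A \<Longrightarrow> adj G x y \<Longrightarrow> reach_in G A x y"
  by (simp add: reach_in_def r_into_rtranclp)

lemma reach_in_sym: "reach_in G A x y \<Longrightarrow> reach_in G A y x"
  unfolding reach_in_def
  by (rule sympD[OF symp_rtranclp]) (auto intro: sympI adj_sym)

lemma reach_in_mono: "reach_in G A x y \<Longrightarrow> A \<subseteq> B \<Longrightarrow> reach_in G B x y"
  unfolding reach_in_def by (erule rtranclp_mono[THEN predicate2D, rotated]) auto

lemma conn_in_reach: "conn_in G A \<Longrightarrow> x \<in> A \<Longrightarrow> y \<in> A \<Longrightarrow> A \<subseteq> B \<Longrightarrow> reach_in G B x y"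
  by (auto simp: conn_in_def intro: reach_in_mono)

lemma conn_in_star:
  assumes "\<And>x. x \<in> A \<Longrightarrow> reach_in G A x c"
  shows "conn_in G A"
  using assms reach_in_sym reach_in_trans unfolding conn_in_def by metis

lemma conn_in_Un:
  assumes "conn_in G A" "conn_in G B" "c \<in> A" "c \<in> B"
  shows "conn_in G (A \<union> B)"
  by (rule conn_in_star[where c = c]) (use assms in \<open>auto intro: conn_in_reach\<close>)

lemma conn_in_singleton: "conn_in G {x}"
  by (simp add: conn_in_def)

lemma conn_in_insert:
  assumes "conn_in G A" "c \<in> A" "adj G x c"
  shows "conn_in G (insert x A)"
proof (rule conn_in_star[where c = c])
  fix y assume "y \<in> insert x A"
  then show "reach_in G (insert x A) y c"
    using assms by (auto intro: conn_in_reach reach_in_step)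
qed

lemma conn_in_walk: "successively (adj G) xs \<Longrightarrow> conn_in G (set xs)"
proof (induction xs)
  case Nil
  then show ?case by (simp add: conn_in_def)
next
  case (Cons x xs)
  then show ?case
    by (cases xs) (auto intro!: conn_in_insert conn_in_singleton simp: insert_absorb)
qed

text \<open>Built from the back: if the new first vertex already lies on the path found for the
  tail, everything before that occurrence is dropped.\<close>

lemma walk_to_path:
  assumes "successively P xs" "xs \<noteq> []"
  obtains ys where "successively P ys" "distinct ys" "ys \<noteq> []" "hd ys = hd xs" "last ys = last xs"
    "set ys \<subseteq> set xs"
  using assms
proof (induction xs arbitrary: thesis)
  case Nil
  then show ?case by simp
next
  case (Cons x xs)
  show ?case
  proof (cases "xs = []")
    case True
    then show ?thesis using Cons.prems(1)[of "[x]"] by simp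
  next
    case False
    then have "successively P xs" "P x (hd xs)"
      using Cons.prems(2) by (auto simp: successively_Cons)
    with False Cons.IH obtain ys where ys: "successively P ys" "distinct ys" "ys \<noteq> []"
      "hd ys = hd xs" "last ys = last xs" "set ys \<subseteq> set xs" by metis
    show ?thesis
    proof (cases "x \<in> set ys")
      case True
      then obtain as bs where "ys = as @ x # bs" by (metis split_list)
      with ys False show ?thesis
        by (intro Cons.prems(1)[of "x # bs"]) (auto simp: successively_append_iff)
    next
      case False
      with ys \<open>P x (hd xs)\<close> \<open>xs \<noteq> []\<close> show ?thesis
        by (intro Cons.prems(1)[of "x # ys"]) (auto simp: successively_Cons)
    qed
  qed
qed

lemma reach_in_walk:
  assumes "reach_in G A x y" "x \<in> A"
  obtains xs where "successively (adj G) xs" "xs \<noteq> []" "hd xs = x" "last xs = y" "set xs \<subseteq> A"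
proof -
  have "\<exists>xs. successively (adj G) xs \<and> xs \<noteq> [] \<and> hd xs = x \<and> last xs = y \<and> set xs \<subseteq> A"
    using assms unfolding reach_in_def
  proof (induction rule: rtranclp_induct)
    case base
    then show ?case by (intro exI[of _ "[x]"]) simp
  next
    case (step y z)
    then obtain xs where "successively (adj G) xs" "xs \<noteq> []" "hd xs = x" "last xs = y" "set xs \<subseteq> A"
      by blast
    with step.hyps(2) show ?case
      by (intro exI[of _ "xs @ [z]"]) (auto simp: successively_append_iff)
  qed
  with that show thesis by blast
qed

lemma path_between_iff_reach_in:
  assumes "x \<in> verts G"
  shows "(\<exists>p. path_between G x y p) \<longleftrightarrow> reach_in G (verts G) x y"
proof
  assume "\<exists>p. path_between G x y p"
  then obtain p where p: "p \<noteq> []" "set p \<subseteq> verts G" "successively (adj G) p" "hd p = x" "last p = y"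
    by (auto simp: path_between_def is_path_iff)
  then have "reach_in G (set p) x y"
    using conn_in_walk[OF p(3)] by (auto simp: conn_in_def)
  with p(2) show "reach_in G (verts G) x y" by (rule reach_in_mono[rotated])
next
  assume "reach_in G (verts G) x y"
  then obtain xs where xs: "successively (adj G) xs" "xs \<noteq> []" "hd xs = x" "last xs = y" "set xs \<subseteq> verts G"
    using assms by (rule reach_in_walk)
  from xs(1,2) obtain ys where "successively (adj G) ys" "distinct ys" "ys \<noteq> []" "hd ys = hd xs"
    "last ys = last xs" "set ys \<subseteq> set xs" by (rule walk_to_path)
  with xs show "\<exists>p. path_between G x y p"
    by (intro exI[of _ ys]) (auto simp: path_between_def is_path_iff)
qed

lemma graph_connected_iff: "graph_connected G \<longleftrightarrow> conn_in G (verts G)"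
  by (simp add: graph_connected_def conn_in_def path_between_iff_reach_in)

lemma graph_connected_induced_iff: "graph_connected (induced G A) \<longleftrightarrow> conn_in G A"
proof -
  have "reach_in (induced G A) A = reach_in G A"
    unfolding reach_in_def
    by (rule arg_cong[of _ _ rtranclp]) (auto simp: fun_eq_iff adj_def induced_def edges_def)
  then show ?thesis
    by (simp add: graph_connected_iff conn_in_def) (simp add: induced_def verts_def)
qed

section \<open>Splitting a corridor\<close>

text \<open>Infinite edge-connectivity between \<open>U\<close> and \<open>V\<close> after contracting both, without leaving \<open>G\<close>.\<close>

definition linked :: "'a graph \<Rightarrow> 'a set \<Rightarrow> 'a set \<Rightarrow> 'a set \<Rightarrow> bool" where
  "linked G U V X \<longleftrightarrow> (\<forall>F. finite F \<longrightarrow>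
     (\<exists>u\<in>U. \<exists>v\<in>V. \<exists>xs. set xs \<subseteq> X \<and> successively (adj_avoiding G F) (u # xs @ [v])))"

lemma linked_sym: 
  assumes "linked G U V X" shows "linked G V U X"
  unfolding linked_def
proof (intro allI impI)
  fix F :: "'a set set" assume "finite F"
  with assms obtain u v xs where *: "u \<in> U" "v \<in> V" "set xs \<subseteq> X"
    "successively (adj_avoiding G F) (u # xs @ [v])"
    unfolding linked_def by blast
  from *(4) have "successively (adj_avoiding G F) (rev (u # xs @ [v]))"
    unfolding successively_rev by (rule successively_mono) (auto intro: adj_sym simp: insert_commute)
  with * show "\<exists>u\<in>V. \<exists>v\<in>U. \<exists>xs. set xs \<subseteq> X \<and> successively (adj_avoiding G F) (u # xs @ [v])"
    by (intro bexI[of _ v] bexI[of _ u] exI[of _ "rev xs"]) auto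
qed

text \<open>Each connecting walk is cut at its last vertex in \<open>U'\<close>. The rest starts in
  \<open>U'\<close> and has no further interior vertex there, so it still avoids
  \<open>F\<close>.\<close>

lemma linked_grow_left:
  assumes "linked G U V X" "U \<subseteq> U'"
  shows "linked G U' V (X - U')"
  unfolding linked_def
proof (intro allI impI)
  fix F :: "'a set set" assume "finite F"
  with assms(1) obtain u v xs where *: "u \<in> U" "v \<in> V" "set xs \<subseteq> X"
    "successively (adj_avoiding G F) (u # xs @ [v])"
    unfolding linked_def by blast
  from * assms(2) have "\<exists>x\<in>set (u # xs). x \<in> U'" by auto
  then obtain as u' bs where bs: "u # xs = as @ u' # bs" "u' \<in> U'" "\<forall>x\<in>set bs. x \<notin> U'"
    by (rule split_list_last_propE)
  have "u # xs @ [v] = as @ u' # bs @ [v]" using bs(1) by (metis append_Cons append_assoc)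
  with *(4) have "successively (adj_avoiding G F) (u' # bs @ [v])"
    by (simp add: successively_append_iff)
  moreover have "set bs \<subseteq> X"
    using *(3) bs(1) by (cases as) auto
  ultimately show "\<exists>u\<in>U'. \<exists>v\<in>V. \<exists>xs. set xs \<subseteq> X - U' \<and> successively (adj_avoiding G F) (u # xs @ [v])"
    using bs *(2) by blast
qed

lemma linked_grow_right:
  assumes "linked G U V X" "V \<subseteq> V'"
  shows "linked G U V' (X - V')"
  using linked_grow_left[OF linked_sym[OF assms(1)] assms(2)] by (rule linked_sym)

text \<open>If every index failed for some finite set, the union of these finitely many sets would
  defeat all indices at once. Think of \<open>Q i F\<close> as index \<open>i\<close> surviving the
  deletion of \<open>F\<close>.\<close>

lemma antimono_pigeonhole:
  assumes "finite I" and ex: "\<And>F. finite F \<Longrightarrow> \<exists>i\<in>I. Q i F"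
    and anti: "\<And>i F F'. Q i F' \<Longrightarrow> F \<subseteq> F' \<Longrightarrow> Q i F"
  shows "\<exists>i\<in>I. \<forall>F. finite F \<longrightarrow> Q i F"
proof (rule ccontr)
  assume "\<not> ?thesis"
  then have "\<forall>i\<in>I. \<exists>F. finite F \<and> \<not> Q i F" by blast
  then obtain f where f: "\<forall>i\<in>I. finite (f i) \<and> \<not> Q i (f i)" by metis
  with assms(1) ex[of "\<Union> (f ` I)"] obtain i where "i \<in> I" "Q i (\<Union> (f ` I))" by auto
  with anti f show False by blast
qed

text \<open>Otherwise paths with pairwise disjoint interiors can be chosen greedily forever. Since
  \<open>U\<close> and \<open>V\<close> are finite, infinitely many of them share both ends. The
  condition \<open>xs \<noteq> []\<close> excludes direct edges, which have no interior to
  hit.\<close>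

lemma finite_hitting_set:
  assumes "\<not> inf_indep_paths G" "finite U" "finite V"
    and disj: "U \<inter> V = {}" "U \<inter> X = {}" "V \<inter> X = {}" and sub: "U \<subseteq> verts G" "V \<subseteq> verts G" "X \<subseteq> verts G"
  obtains S where "finite S" "S \<subseteq> X"
    "\<And>u xs v. u \<in> U \<Longrightarrow> v \<in> V \<Longrightarrow> set xs \<subseteq> X \<Longrightarrow> xs \<noteq> [] \<Longrightarrow> successively (adj G) (u # xs @ [v]) \<Longrightarrow>
        set xs \<inter> S \<noteq> {}"
proof -
  define good where "good = (\<lambda>(u, xs, v). u \<in> U \<and> v \<in> V \<and> set xs \<subseteq> X \<and> xs \<noteq> [] \<and> distinct xs \<and>
    successively (adj G) (u # xs @ [v]))"
  have "\<exists>S. finite S \<and> S \<subseteq> X \<and> (\<forall>p. good p \<longrightarrow> set (fst (snd p)) \<inter> S \<noteq> {})"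
  proof (rule ccontr)
    assume "\<not> ?thesis"
    then have "\<forall>S. \<exists>p. finite S \<and> S \<subseteq> X \<longrightarrow> good p \<and> set (fst (snd p)) \<inter> S = {}" by blast
    then obtain g where g: "\<And>S. finite S \<Longrightarrow> S \<subseteq> X \<Longrightarrow> good (g S) \<and> set (fst (snd (g S))) \<inter> S = {}"
      by metis
    \<comment> \<open>\<open>T n\<close> collects the interiors of the first \<open>n\<close> chosen
      paths, so the next path \<open>g (T n)\<close> is disjoint from all of them inside.\<close>
    define T where "T n = ((\<lambda>S. S \<union> set (fst (snd (g S)))) ^^ n) {}" for n
    have T_Suc: "T (Suc n) = T n \<union> set (fst (snd (g (T n))))" for n by (simp add: T_def)
    have T: "finite (T n) \<and> T n \<subseteq> X" for n
    proof (induction n)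
      case 0
      then show ?case by (simp add: T_def)
    next
      case (Suc n)
      with g[of "T n"] show ?case by (auto simp: T_Suc good_def split: prod.splits)
    qed
    define f where "f n = g (T n)" for n
    have f: "good (f n)" "set (fst (snd (f n))) \<inter> T n = {}" for n
      using g T by (auto simp: f_def)
    have "mono T" by (rule mono_iff_le_Suc[THEN iffD2]) (simp add: T_Suc)
    have dj: "set (fst (snd (f i))) \<inter> set (fst (snd (f j))) = {}" if "i < j" for i j
    proof -
      have "set (fst (snd (f i))) \<subseteq> T (Suc i)" by (simp add: T_Suc f_def)
      also have "\<dots> \<subseteq> T j" using \<open>mono T\<close> that by (simp add: monoD)
      finally show ?thesis using f(2)[of j] by blast
    qed
    \<comment> \<open>Only finitely many end pairs are available, so one pair occurs for infinitely
      many \<open>n\<close>.\<close>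
    have "(\<lambda>n. (fst (f n), snd (snd (f n)))) ` UNIV \<subseteq> U \<times> V"
      using f(1) by (auto simp: good_def case_prod_beta)
    then have "finite ((\<lambda>n. (fst (f n), snd (snd (f n)))) ` UNIV)"
      by (rule finite_subset) (use assms in auto)
    from pigeonhole_infinite[OF infinite_UNIV_nat this] obtain n0 where
      inf: "infinite {n. (fst (f n), snd (snd (f n))) = (fst (f n0), snd (snd (f n0)))}" by auto
    define N where "N = {n. (fst (f n), snd (snd (f n))) = (fst (f n0), snd (snd (f n0)))}"
    define u v where "u = fst (f n0)" and "v = snd (snd (f n0))"
    define h where "h n = u # fst (snd (f n)) @ [v]" for n
    have uv: "u \<in> U" "v \<in> V" using f(1)[of n0] by (auto simp: u_def v_def good_def split: prod.splits)
    have inner: "inner_verts (h n) = set (fst (snd (f n)))" for n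
      by (simp add: h_def inner_verts_def)
    have ne: "set (fst (snd (f n))) \<noteq> {}" for n
      using f(1)[of n] by (auto simp: good_def split: prod.splits)
    have djh: "inner_verts (h i) \<inter> inner_verts (h j) = {}" if "i \<noteq> j" for i j
      using dj[of i j] dj[of j i] that by (auto simp: inner linorder_neq_iff)
    have "inj h"
    proof (rule injI)
      fix i j assume "h i = h j"
      then have "fst (snd (f i)) = fst (snd (f j))" by (simp add: h_def)
      with dj[of i j] dj[of j i] ne[of i] show "i = j" by (cases i j rule: linorder_cases) auto
    qed
    then have "infinite (h ` N)" using inf by (auto simp: N_def finite_image_iff inj_on_subset)
    moreover have "path_between G u v (h n)" if nN: "n \<in> N" for n
    proof -
      obtain xs where fn: "f n = (u, xs, v)"
        using nN by (cases "f n") (auto simp: N_def u_def v_def)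
      with f(1)[of n] disj sub uv show ?thesis
        by (auto simp: h_def path_between_def is_path_iff good_def)
    qed
    moreover have "\<forall>p\<in>h ` N. \<forall>q\<in>h ` N. p \<noteq> q \<longrightarrow> inner_verts p \<inter> inner_verts q = {}"
    proof (intro ballI impI)
      fix p q assume "p \<in> h ` N" "q \<in> h ` N" "p \<noteq> q"
      then obtain i j where "p = h i" "q = h j" "i \<noteq> j" by blast
      then show "inner_verts p \<inter> inner_verts q = {}" by (simp add: djh)
    qed
    moreover have "u \<noteq> v" "u \<in> verts G" "v \<in> verts G" using uv disj sub by auto
    ultimately have "inf_indep_paths G"
      unfolding inf_indep_paths_def by blast
    with assms(1) show False by simp
  qed
  then obtain S where S: "finite S" "S \<subseteq> X" "\<And>p. good p \<Longrightarrow> set (fst (snd p)) \<inter> S \<noteq> {}" by blast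
  show thesis
  proof (rule that[OF S(1,2)])
    fix u xs v
    assume *: "u \<in> U" "v \<in> V" "set xs \<subseteq> X" "xs \<noteq> []" "successively (adj G) (u # xs @ [v])"
    \<comment> \<open>Walks reduce to paths: shortcutting the interior keeps its first and last
      vertex and only shrinks its vertex set.\<close>
    then have "successively (adj G) xs" by (auto simp: successively_Cons successively_append_iff)
    with * obtain ys where "successively (adj G) ys" "distinct ys" "ys \<noteq> []" "hd ys = hd xs"
      "last ys = last xs" "set ys \<subseteq> set xs" by (metis walk_to_path)
    moreover from this * have "successively (adj G) (u # ys @ [v])"
      by (auto simp: successively_Cons successively_append_iff)
    ultimately have "good (u, ys, v)" using * by (auto simp: good_def)
    from S(3)[OF this] \<open>set ys \<subseteq> set xs\<close> show "set xs \<inter> S \<noteq> {}" by auto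
  qed
qed

text \<open>The invariant of the recursion. \<open>X\<close> is the territory reserved for
  everything that will later grow between \<open>U\<close> and \<open>V\<close>; finiteness of
  \<open>U\<close> and \<open>V\<close> is what feeds the hitting-set argument.\<close>

definition corridor :: "'a graph \<Rightarrow> 'a set \<Rightarrow> 'a set \<Rightarrow> 'a set \<Rightarrow> bool" where
  "corridor G U V X \<longleftrightarrow> U \<subseteq> verts G \<and> V \<subseteq> verts G \<and> X \<subseteq> verts G \<and>
     U \<inter> V = {} \<and> U \<inter> X = {} \<and> V \<inter> X = {} \<and> finite U \<and> finite V \<and> U \<noteq> {} \<and> V \<noteq> {} \<and>
     conn_in G U \<and> conn_in G V \<and> linked G U V X"

section \<open>Subdividing a corridor\<close>

lemma reach_in_finite_conn:
  assumes "reach_in G A x y" "x \<in> A"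
  obtains W where "finite W" "W \<subseteq> A" "conn_in G W" "x \<in> W" "y \<in> W"
proof -
  from assms obtain xs where "successively (adj G) xs" "xs \<noteq> []" "hd xs = x" "last xs = y" "set xs \<subseteq> A"
    by (rule reach_in_walk)
  moreover from this have "x \<in> set xs" "y \<in> set xs" by auto
  ultimately show thesis using that[of "set xs"] conn_in_walk by blast
qed

lemma successively_avoiding: "successively (adj_avoiding G F) xs \<Longrightarrow> successively (adj G) xs"
  by (erule successively_mono) auto

text \<open>The path is absorbed by \<open>U\<close> alone, so right end sets never change when
  passing to a right child.\<close>

lemma corridor_make_adjacent:
  assumes "corridor G U V X"
  obtains U' where "U \<subseteq> U'" "U' \<subseteq> U \<union> X" "corridor G U' V (X - U')" "\<exists>u\<in>U'. \<exists>v\<in>V. adj G u v"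
proof -
  from assms have c: "U \<subseteq> verts G" "V \<subseteq> verts G" "X \<subseteq> verts G" "U \<inter> V = {}" "U \<inter> X = {}" "V \<inter> X = {}"
    "finite U" "finite V" "U \<noteq> {}" "V \<noteq> {}" "conn_in G U" "conn_in G V" and l: "linked G U V X"
    by (simp_all add: corridor_def)
  from l[unfolded linked_def, rule_format, OF finite.emptyI] obtain u v xs where
    *: "u \<in> U" "v \<in> V" "set xs \<subseteq> X" "successively (adj_avoiding G {}) (u # xs @ [v])"
    by blast
  then have w: "successively (adj G) ((u # xs) @ [v])" by simp
  define U' where "U' = U \<union> set (u # xs)"
  have "conn_in G U'" unfolding U'_def
  proof (rule conn_in_Un)
    show "conn_in G (set (u # xs))" using w unfolding successively_append_iff by (blast intro: conn_in_walk)
  qed (use c(11) *(1) in auto)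
  moreover have "linked G U' V (X - U')"
    by (rule linked_grow_left[OF l]) (auto simp: U'_def)
  moreover have "U' \<subseteq> verts G" "finite U'" "U' \<noteq> {}" "U' \<inter> V = {}"
    using c(1-10) *(1-3) unfolding U'_def by auto
  ultimately have "corridor G U' V (X - U')"
    using c unfolding corridor_def by auto
  moreover have "adj G (last (u # xs)) v" using w unfolding successively_append_iff by simp
  then have "\<exists>u\<in>U'. \<exists>v\<in>V. adj G u v"
    using * by (intro bexI[of _ "last (u # xs)"] bexI[of _ v]) (auto simp: U'_def)
  ultimately show thesis using * by (intro that[of U']) (auto simp: U'_def)
qed

text \<open>The two new territories are the parts of \<open>X\<close> reachable from
  \<open>U\<close> and from \<open>V\<close> without meeting the hitting set \<open>S\<close>. They
  are disjoint because a shared vertex would complete a \<open>U\<close>-\<open>V\<close> path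
  missing \<open>S\<close>.\<close>

lemma corridor_cut:
  assumes "\<not> inf_indep_paths G" "corridor G U V X"
  obtains W X1 X2 where "W \<subseteq> X" "X1 \<subseteq> X" "X2 \<subseteq> X" "X1 \<inter> X2 = {}" "corridor G U W X1" "corridor G W V X2"
proof -
  from assms(2) have d: "finite U" "finite V" "U \<inter> V = {}" "U \<inter> X = {}" "V \<inter> X = {}"
    "U \<subseteq> verts G" "V \<subseteq> verts G" "X \<subseteq> verts G" and l: "linked G U V X"
    and c: "U \<noteq> {}" "V \<noteq> {}" "conn_in G U" "conn_in G V" by (simp_all add: corridor_def)
  obtain S where S: "finite S" "S \<subseteq> X" and hit:
    "\<And>u xs v. u \<in> U \<Longrightarrow> v \<in> V \<Longrightarrow> set xs \<subseteq> X \<Longrightarrow> xs \<noteq> [] \<Longrightarrow> successively (adj G) (u # xs @ [v]) \<Longrightarrow>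
        set xs \<inter> S \<noteq> {}"
    by (rule finite_hitting_set[OF assms(1) d]) blast
  \<comment> \<open>\<open>s\<close> is the first and \<open>s'\<close> the last vertex in
    \<open>S\<close>. The stretch from \<open>s\<close> to \<open>s'\<close> need not avoid
    \<open>F\<close>, since it only serves to make \<open>W\<close> connected.\<close>
  define Q where "Q = (\<lambda>(s, s') F. reach_in G X s s' \<and>
    (\<exists>u\<in>U. \<exists>xs. set xs \<subseteq> X - S \<and> successively (adj_avoiding G F) (u # xs @ [s])) \<and>
    (\<exists>v\<in>V. \<exists>xs. set xs \<subseteq> X - S \<and> successively (adj_avoiding G F) (s' # xs @ [v])))"
  have "\<exists>i\<in>S \<times> S. \<forall>F. finite F \<longrightarrow> Q i F"
  proof (rule antimono_pigeonhole)
    show "finite (S \<times> S)" using S by simp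
  next
    fix F :: "'a set set" assume "finite F"
    \<comment> \<open>Direct \<open>U\<close>-\<open>V\<close> edges are forbidden as well, which
      forces a nonempty interior, so \<open>S\<close> must be hit.\<close>
    define F' where "F' = F \<union> (\<lambda>(u, v). {u, v}) ` (U \<times> V)"
    have "finite F'" using \<open>finite F\<close> d by (simp add: F'_def)
    then obtain u v xs where *: "u \<in> U" "v \<in> V" "set xs \<subseteq> X"
      "successively (adj_avoiding G F') (u # xs @ [v])"
      using l unfolding linked_def by blast
    then have "xs \<noteq> []" by (auto simp: F'_def)
    have wF: "successively (adj_avoiding G F) (u # xs @ [v])"
      using *(4) by (rule successively_mono) (auto simp: F'_def)
    with hit * \<open>xs \<noteq> []\<close> have ex: "\<exists>x\<in>set xs. x \<in> S"
      using successively_avoiding[OF wF] by blast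
    from split_list_first_prop[OF ex] obtain as s cs where
      as: "xs = as @ s # cs" "s \<in> S" "\<forall>x\<in>set as. x \<notin> S" by blast
    from split_list_last_prop[OF ex] obtain ds s' bs where
      bs: "xs = ds @ s' # bs" "s' \<in> S" "\<forall>x\<in>set bs. x \<notin> S" by blast
    have "successively (adj G) xs"
      using successively_avoiding[OF wF] by (auto simp: successively_Cons successively_append_iff)
    moreover have sub: "set as \<subseteq> set xs" "s \<in> set xs" by (simp_all add: as(1)) auto
    moreover have sub': "set bs \<subseteq> set xs" "s' \<in> set xs" by (simp_all add: bs(1)) auto
    ultimately have "reach_in G X s s'"
      using *(3) by (intro conn_in_reach[OF conn_in_walk])
    moreover have "successively (adj_avoiding G F) ((u # as @ [s]) @ cs @ [v])"
      using wF as(1) by simp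
    then have "successively (adj_avoiding G F) (u # as @ [s])"
      unfolding successively_append_iff by blast
    moreover have "successively (adj_avoiding G F) ((u # ds) @ s' # bs @ [v])"
      using wF bs(1) by simp
    then have "successively (adj_avoiding G F) (s' # bs @ [v])"
      unfolding successively_append_iff by blast
    moreover have "set as \<subseteq> X - S" "set bs \<subseteq> X - S" using as(3) bs(3) sub(1) sub'(1) *(3) by blast+
    ultimately have "Q (s, s') F" unfolding Q_def using * by blast
    with as bs show "\<exists>i\<in>S \<times> S. Q i F" by blast
  next
    fix i F F' assume "Q i F'" "F \<subseteq> F'"
    moreover have "successively (adj_avoiding G F) xs" if "successively (adj_avoiding G F') xs" for xs
      using that by (rule successively_mono) (use \<open>F \<subseteq> F'\<close> in auto)
    ultimately show "Q i F" unfolding Q_def by (cases i) blast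
  qed
  then obtain s s' where s: "s \<in> S" "s' \<in> S" and Q: "\<And>F. finite F \<Longrightarrow> Q (s, s') F" by blast
  have "reach_in G X s s'" using Q[of "{}"] by (simp add: Q_def)
  then obtain W where W: "finite W" "W \<subseteq> X" "conn_in G W" "s \<in> W" "s' \<in> W"
    using s S by (meson reach_in_finite_conn subsetD)
  define C1 where "C1 = \<Union> {set xs | xs u. u \<in> U \<and> set xs \<subseteq> X - S \<and> successively (adj G) (u # xs)}"
  define C2 where "C2 = \<Union> {set xs | xs v. v \<in> V \<and> set xs \<subseteq> X - S \<and> successively (adj G) (xs @ [v])}"
  have "C1 \<inter> C2 = {}"
  proof (rule ccontr)
    assume "C1 \<inter> C2 \<noteq> {}"
    then obtain x xs ys u v where *: "x \<in> set xs" "x \<in> set ys" "u \<in> U" "v \<in> V" "set xs \<subseteq> X - S" "set ys \<subseteq> X - S"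
      "successively (adj G) (u # xs)" "successively (adj G) (ys @ [v])"
      unfolding C1_def C2_def by blast
    then obtain as bs cs ds where sp: "xs = as @ x # bs" "ys = cs @ x # ds"
      by (meson split_list)
    have "successively (adj G) (((u # as) @ [x]) @ bs)" "successively (adj G) (cs @ x # ds @ [v])"
      using *(7,8) sp by auto
    then have "successively (adj G) ((u # as) @ [x])" "successively (adj G) (x # ds @ [v])"
      unfolding successively_append_iff by blast+
    \<comment> \<open>Splicing at \<open>x\<close>: from \<open>u\<close> to \<open>x\<close> along
      the first walk, then on to \<open>v\<close> along the second, always outside
      \<open>S\<close>.\<close>
    then have "successively (adj G) ((u # as) @ x # ds @ [v])"
      unfolding successively_append_iff[of _ "u # as"] by simp
    then have "successively (adj G) (u # (as @ x # ds) @ [v])" by simp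
    from hit[OF *(3,4) _ _ this] *(5,6) sp show False by auto
  qed
  have "linked G U {s} C1" unfolding linked_def
  proof (intro allI impI)
    fix F :: "'a set set" assume "finite F"
    from Q[OF this] obtain u xs where *: "u \<in> U" "set xs \<subseteq> X - S" "successively (adj_avoiding G F) (u # xs @ [s])"
      unfolding Q_def by blast
    have "successively (adj G) ((u # xs) @ [s])" using successively_avoiding[OF *(3)] by simp
    then have "successively (adj G) (u # xs)" unfolding successively_append_iff by blast
    then have "set xs \<subseteq> C1" using * unfolding C1_def by blast
    with * show "\<exists>u\<in>U. \<exists>v\<in>{s}. \<exists>xs. set xs \<subseteq> C1 \<and> successively (adj_avoiding G F) (u # xs @ [v])"
      by blast
  qed
  then have l1: "linked G U W (C1 - W)" by (rule linked_grow_right) (use W in simp)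
  have "linked G {s'} V C2" unfolding linked_def
  proof (intro allI impI)
    fix F :: "'a set set" assume "finite F"
    from Q[OF this] obtain v xs where *: "v \<in> V" "set xs \<subseteq> X - S" "successively (adj_avoiding G F) (s' # xs @ [v])"
      unfolding Q_def by blast
    have "successively (adj G) (xs @ [v])"
      using successively_avoiding[OF *(3)] by (simp add: successively_Cons)
    then have "set xs \<subseteq> C2" using * unfolding C2_def by blast
    with * show "\<exists>u\<in>{s'}. \<exists>v\<in>V. \<exists>xs. set xs \<subseteq> C2 \<and> successively (adj_avoiding G F) (u # xs @ [v])"
      by blast
  qed
  then have l2: "linked G W V (C2 - W)" by (rule linked_grow_left) (use W in simp)
  have C: "C1 \<subseteq> X" "C2 \<subseteq> X" by (auto simp: C1_def C2_def)
  show thesis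
  proof (rule that[of W "C1 - W" "C2 - W"])
    have "W \<noteq> {}" "U \<inter> W = {}" "V \<inter> W = {}" "W \<subseteq> verts G" "C1 - W \<subseteq> verts G" "C2 - W \<subseteq> verts G"
      "U \<inter> (C1 - W) = {}" "V \<inter> (C2 - W) = {}"
      using W(2,4) C d by blast+
    with l1 l2 W c d show "corridor G U W (C1 - W)" "corridor G W V (C2 - W)"
      by (simp_all add: corridor_def Int_commute)
  qed (use W(2) C \<open>C1 \<inter> C2 = {}\<close> in blast)+
qed

text \<open>The triples are a node, its left child and its right child, with \<open>V1 = U2\<close>
  the new middle set. As \<open>U1\<close> may have grown into \<open>X\<close>, its disjointness
  from \<open>X2\<close> is recorded separately.\<close>

definition splits :: "'a graph \<Rightarrow> 'a set \<times> 'a set \<times> 'a set \<Rightarrow> 'a set \<times> 'a set \<times> 'a set \<Rightarrow> 'a set \<times> 'a set \<times> 'a set \<Rightarrow> bool"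
  where "splits G = (\<lambda>(U, V, X) (U1, V1, X1) (U2, V2, X2).
    U \<subseteq> U1 \<and> U1 \<subseteq> U \<union> X \<and> V2 = V \<and> V1 = U2 \<and> U2 \<subseteq> X \<and> X1 \<subseteq> X \<and> X2 \<subseteq> X \<and> X1 \<inter> X2 = {} \<and>
    U1 \<inter> X2 = {} \<and> (\<exists>u\<in>U1. \<exists>v\<in>V2. adj G u v))"

lemma corridor_splits:
  assumes "\<not> inf_indep_paths G" "corridor G U V X"
  shows "\<exists>U1 V1 X1 U2 V2 X2. splits G (U, V, X) (U1, V1, X1) (U2, V2, X2) \<and>
    corridor G U1 V1 X1 \<and> corridor G U2 V2 X2"
proof -
  from assms(2) obtain U' where U': "U \<subseteq> U'" "U' \<subseteq> U \<union> X" "corridor G U' V (X - U')"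
    "\<exists>u\<in>U'. \<exists>v\<in>V. adj G u v" by (rule corridor_make_adjacent)
  from assms(1) U'(3) obtain W X1 X2 where W: "W \<subseteq> X - U'" "X1 \<subseteq> X - U'" "X2 \<subseteq> X - U'" "X1 \<inter> X2 = {}"
    "corridor G U' W X1" "corridor G W V X2" by (rule corridor_cut)
  have "splits G (U, V, X) (U', W, X1) (W, V, X2)"
    unfolding splits_def using U'(1,2,4) W(1-4) by (auto 0 2)
  with W show ?thesis by blast
qed

section \<open>The Farey graph and the Stern-Brocot tree\<close>

definition vdet :: "int \<times> int \<Rightarrow> int \<times> int \<Rightarrow> int" where
  "vdet v w = fst v * snd w - snd v * fst w"

lemma adj_Farey_iff: "adj Farey x y \<longleftrightarrow> \<bar>vdet (frac x) (frac y)\<bar> = 1"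
proof -
  have "\<bar>vdet (frac y) (frac x)\<bar> = \<bar>vdet (frac x) (frac y)\<bar>" for x y
    unfolding vdet_def by (simp add: abs_minus_commute mult.commute)
  moreover have "x \<noteq> y" if "\<bar>vdet (frac x) (frac y)\<bar> = 1"
    using that by (auto simp: vdet_def mult.commute)
  ultimately show ?thesis
    unfolding adj_def Farey_def edges_def
    by (auto simp: doubleton_eq_iff case_prod_beta vdet_def Let_def)
qed

lemma verts_Farey [simp]: "verts Farey = UNIV"
  by (simp add: Farey_def verts_def)

lemma wf_graph_Farey: "wf_graph Farey"
proof -
  have "\<exists>x y. x \<noteq> y \<and> e = {x, y}" if "e \<in> edges Farey" for e
  proof -
    from that obtain x y where e: "e = {x, y}" "\<bar>vdet (frac x) (frac y)\<bar> = 1"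
      by (auto simp: Farey_def edges_def case_prod_beta vdet_def Let_def)
    then have "adj Farey x y" by (simp add: adj_Farey_iff)
    with e show ?thesis by (auto simp: adj_def)
  qed
  then show ?thesis by (auto simp: wf_graph_def)
qed

section \<open>Vertices as primitive integer vectors up to sign\<close>

definition vertex_of :: "int \<times> int \<Rightarrow> rat option" where
  "vertex_of v = (if snd v = 0 then None else Some (Fract (fst v) (snd v)))"

lemma frac_vertex_of:
  assumes "coprime (fst v) (snd v)" "snd v \<ge> 0"
  shows "frac (vertex_of v) = (if snd v = 0 then (1, 0) else v)"
  using assms by (cases v) (auto simp: frac_def vertex_of_def quotient_of_Fract Rat.normalize_def)

lemma vertex_of_frac: "vertex_of (frac x) = x"
proof (cases x)
  case (Some q)
  obtain a b where "quotient_of q = (a, b)" by force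
  with Some quotient_of_denom_pos[OF this] quotient_of_div[OF this] show ?thesis
    by (simp add: frac_def vertex_of_def Fract_of_int_quotient)
qed (simp add: frac_def vertex_of_def)

lemma frac_props: "coprime (fst (frac x)) (snd (frac x))" "snd (frac x) \<ge> 0"
    "snd (frac x) = 0 \<Longrightarrow> frac x = (1, 0)"
  using quotient_of_coprime quotient_of_denom_pos'
  by (auto simp: frac_def split: option.splits) (metis less_le prod.collapse)+

lemma inj_frac: "inj frac"
  by (metis injI vertex_of_frac)

text \<open>Words over \<open>bool\<close> (\<open>False\<close>: left, \<open>True\<close>: right) are the nodes of the Stern--Brocot tree on
  the interval from 0 to \<open>\<infinity>\<close>; each prefixed letter acts as one of the two generators of
  \<open>SL\<^sub>2(\<nat>)\<close>, so that the node \<open>t\<close> has end points \<open>sb t (0, 1)\<close>, \<open>sb t (1, 0)\<close> and mediant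
  \<open>sb t (1, 1)\<close>.\<close>

primrec sb :: "bool list \<Rightarrow> int \<times> int \<Rightarrow> int \<times> int" where
  "sb [] v = v"
| "sb (b # t) v = (let (p, q) = sb t v in if b then (p + q, q) else (p, p + q))"

section \<open>Determinants, growth and uniqueness in the tree\<close>

lemma sb_append: "sb (s @ t) v = sb s (sb t v)"
  by (induction s) simp_all

lemma sb_nonneg: "fst v \<ge> 0 \<Longrightarrow> snd v \<ge> 0 \<Longrightarrow> fst (sb t v) \<ge> 0 \<and> snd (sb t v) \<ge> 0"
  by (induction t) (auto simp: case_prod_beta Let_def)

text \<open>Both generators are shears of determinant 1.\<close>

lemma vdet_sb: "vdet (sb t v) (sb t w) = vdet v w"
  by (induction t) (auto simp: case_prod_beta Let_def vdet_def algebra_simps)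

lemma coprime_sb: "coprime (fst (sb t v)) (snd (sb t v)) \<longleftrightarrow> coprime (fst v) (snd v)"
  by (induction t)
     (auto simp: case_prod_beta Let_def coprime_iff_gcd_eq_1 gcd_add1 gcd_add2 add.commute)


lemma sb_mediant: "fst (sb t (1, 1)) = fst (sb t (0, 1)) + fst (sb t (1, 0))"
  "snd (sb t (1, 1)) = snd (sb t (0, 1)) + snd (sb t (1, 0))"
  by (induction t) (auto simp: case_prod_beta Let_def)

lemma sb_mediant_pos: "fst (sb t (1, 1)) > 0 \<and> snd (sb t (1, 1)) > 0"
  by (induction t) (auto simp: case_prod_beta Let_def)

text \<open>Each letter adds one positive coordinate to the other, so the coordinate sum grows by at
  least 1 per level.\<close>

lemma sb_mediant_size: "fst (sb t (1, 1)) + snd (sb t (1, 1)) \<ge> int (length t)"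
proof (induction t)
  case (Cons b t)
  with sb_mediant_pos[of t] show ?case by (auto simp: case_prod_beta Let_def)
qed simp

text \<open>The first letter can be read off the mediant: it tells which coordinate is strictly
  larger, and only the root has equal coordinates.\<close>

lemma inj_sb_mediant: "sb s (1, 1) = sb t (1, 1) \<Longrightarrow> s = t"
proof (induction s arbitrary: t)
  case Nil
  then show ?case
  proof (cases t)
    case (Cons c t')
    with Nil sb_mediant_pos[of t'] show ?thesis by (auto simp: case_prod_beta Let_def split: if_splits)
  qed simp
next
  case (Cons b s)
  from Cons.prems show ?case
  proof (cases t)
    case Nil
    with Cons.prems sb_mediant_pos[of s] show ?thesis by (auto simp: case_prod_beta Let_def split: if_splits)
  next
    case (Cons c t')
    with Cons.prems sb_mediant_pos[of s] sb_mediant_pos[of t'] have "b = c" "sb s (1, 1) = sb t' (1, 1)"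
      by (auto simp: case_prod_beta Let_def prod_eq_iff split: if_splits)
    with Cons Cons.IH show ?thesis by simp
  qed
qed

text \<open>The Euclidean algorithm run on both vectors at once: determinant 1 makes them agree on
  which coordinate is the larger one, unless they are already the two base vectors. Each subtraction
  strips one letter.\<close>

lemma sb_surj_edges:
  assumes "p \<ge> 0" "q \<ge> 0" "p' \<ge> 0" "q' \<ge> 0" "p' * q - p * q' = (1::int)"
  shows "\<exists>t. sb t (0, 1) = (p, q) \<and> sb t (1, 0) = (p', q')"
  using assms
proof (induction "nat (p + q + p' + q')" arbitrary: p q p' q' rule: less_induct)
  case less
  note h = less.prems
  consider "p \<le> q" "p' \<le> q'" | "q \<le> p" "q' \<le> p'" | "p < q" "q' < p'" | "q < p" "p' < q'" by linarith
  then show ?case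
  proof cases
    case 1
    \<comment> \<open>Makes the sum of the entries drop; \<open>p = p' = 0\<close> would give
      determinant 0.\<close>
    have "p + p' > 0" using h by (cases "p = 0 \<and> p' = 0") auto
    with 1 h have "\<exists>t. sb t (0, 1) = (p, q - p) \<and> sb t (1, 0) = (p', q' - p')"
      by (intro less.hyps) (auto simp: algebra_simps)
    then obtain t where "sb t (0, 1) = (p, q - p)" "sb t (1, 0) = (p', q' - p')" by blast
    then show ?thesis by (intro exI[of _ "False # t"]) simp
  next
    case 2
    have "q + q' > 0" using h by (cases "q = 0 \<and> q' = 0") auto
    with 2 h have "\<exists>t. sb t (0, 1) = (p - q, q) \<and> sb t (1, 0) = (p' - q', q')"
      by (intro less.hyps) (auto simp: algebra_simps)
    then obtain t where "sb t (0, 1) = (p - q, q)" "sb t (1, 0) = (p' - q', q')" by blast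
    then show ?thesis by (intro exI[of _ "True # t"]) simp
  next
    case 3
    \<comment> \<open>By integrality the determinant is at least \<open>p + q' + 1\<close>, which
      leaves only the base vectors, that is, the empty word.\<close>
    then have "(q' + 1) * (p + 1) \<le> p' * q" using h by (intro mult_mono) auto
    with h have "p = 0" "q' = 0" by (auto simp: algebra_simps)
    with h have "p' = 1" "q = 1" by (auto simp: pos_zmult_eq_1_iff_lemma zmult_eq_1_iff)
    with \<open>p = 0\<close> \<open>q' = 0\<close> show ?thesis by (intro exI[of _ "[]"]) simp
  next
    case 4
    then have "p' * q \<le> q' * p" using h by (intro mult_mono) auto
    with h show ?thesis by (simp add: algebra_simps)
  qed
qed

text \<open>The sign can only flip at \<open>(-1, 0)\<close>, a second representative of
  \<open>\<infinity>\<close>. Absolute determinants do not see this.\<close>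

lemma frac_vertex_of_cases:
  assumes "coprime (fst v) (snd v)" "snd v \<ge> 0"
  shows "frac (vertex_of v) = v \<or> frac (vertex_of v) = (- fst v, - snd v)"
  using frac_vertex_of[OF assms] assms(1) by (cases v) (auto split: if_splits)

lemma abs_vdet_vertex_of:
  assumes "coprime (fst v) (snd v)" "snd v \<ge> 0" "coprime (fst w) (snd w)" "snd w \<ge> 0"
  shows "\<bar>vdet (frac (vertex_of v)) (frac (vertex_of w))\<bar> = \<bar>vdet v w\<bar>"
  using frac_vertex_of_cases[OF assms(1,2)] frac_vertex_of_cases[OF assms(3,4)]
  by (auto simp: vdet_def abs_minus_commute)

text \<open>The full circle: the root word stands for the degenerate interval from \<open>\<infinity>\<close> to \<open>\<infinity>\<close> with
  mediant 0, and the negative half is the image of the positive one under \<open>x \<mapsto> -1/x\<close>.\<close>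

definition farey_vec :: "bool list \<Rightarrow> int \<times> int \<Rightarrow> int \<times> int" where
  "farey_vec w v = (if hd w then sb (tl w) v else (- snd (sb (tl w) v), fst (sb (tl w) v)))"

definition lft :: "bool list \<Rightarrow> rat option" where
  "lft w = (if w = [] then None else vertex_of (farey_vec w (0, 1)))"

definition rgt :: "bool list \<Rightarrow> rat option" where
  "rgt w = (if w = [] then None else vertex_of (farey_vec w (1, 0)))"

definition mid :: "bool list \<Rightarrow> rat option" where
  "mid w = (if w = [] then Some 0 else vertex_of (farey_vec w (1, 1)))"

lemma ends_Nil [simp]: "lft [] = None" "rgt [] = None"
  by (simp_all add: lft_def rgt_def)

text \<open>The last letter acts first on the base vectors: it fixes one of them and sends the other
  to \<open>(1, 1)\<close>. Hence appending a letter passes to a child.\<close>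

lemma ends_snoc [simp]:
  "lft (w @ [False]) = lft w" "rgt (w @ [False]) = mid w"
  "lft (w @ [True]) = mid w" "rgt (w @ [True]) = rgt w"
  by (cases w; simp add: lft_def rgt_def mid_def farey_vec_def sb_append vertex_of_def rat_number_collapse)+

lemma farey_vec_props:
  assumes "fst v \<ge> 0" "snd v \<ge> 0" "coprime (fst v) (snd v)"
  shows "snd (farey_vec w v) \<ge> 0" "coprime (fst (farey_vec w v)) (snd (farey_vec w v))"
  using sb_nonneg[OF assms(1,2)] assms(3) by (auto simp: farey_vec_def coprime_sb coprime_commute)

lemma frac_mid:
  "frac (mid w) = (if w = [] then (0, 1) else farey_vec w (1, 1))"
  using frac_vertex_of[OF farey_vec_props(2,1), of "(1, 1)" w] sb_mediant_pos[of "tl w"]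
  by (auto simp: mid_def frac_def farey_vec_def split: if_splits)

lemma mid_neq_None: "mid w \<noteq> None"
proof
  assume "mid w = None"
  then have "snd (frac (mid w)) = 0" by (simp add: frac_def)
  with sb_mediant_pos[of "tl w"] show False
    unfolding frac_mid by (auto simp: farey_vec_def split: if_splits)
qed

text \<open>The sign of the first coordinate separates the root mediant 0 from the two halves;
  within a half, injectivity on the positive tree applies.\<close>

lemma inj_mid: "inj mid"
proof (rule injI)
  fix v w assume "mid v = mid w"
  then have "(if v = [] then (0, 1) else farey_vec v (1, 1)) = (if w = [] then (0, 1) else farey_vec w (1, 1))"
    by (metis frac_mid)
  then show "v = w"
    using sb_mediant_pos[of "tl v"] sb_mediant_pos[of "tl w"] inj_sb_mediant[of "tl v" "tl w"]
    by (cases v; cases w) (auto simp: farey_vec_def prod_eq_iff split: if_splits)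
qed

lemma vdet_farey_vec: "vdet (farey_vec w v) (farey_vec w v') = vdet v v'"
  using vdet_sb[of "tl w" v v'] by (auto simp: farey_vec_def vdet_def algebra_simps)

text \<open>The root must be excluded: its two ends are both \<open>\<infinity>\<close>.\<close>

lemma adj_ends:
  assumes "w \<noteq> []"
  shows "adj Farey (lft w) (rgt w)"
  using abs_vdet_vertex_of[of "farey_vec w (0, 1)" "farey_vec w (1, 0)"] assms
    farey_vec_props[of "(0, 1)" w] farey_vec_props[of "(1, 0)" w]
  by (simp add: adj_Farey_iff lft_def rgt_def vdet_farey_vec) (simp add: vdet_def)

definition height :: "rat option \<Rightarrow> int" where
  "height x = \<bar>fst (frac x)\<bar> + \<bar>snd (frac x)\<bar>"

lemma height_vertex_of:
  assumes "coprime (fst v) (snd v)" "snd v \<ge> 0"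
  shows "height (vertex_of v) = \<bar>fst v\<bar> + \<bar>snd v\<bar>"
  using frac_vertex_of_cases[OF assms] by (auto simp: height_def)

text \<open>The two heights add up to the coordinate sum of the mediant at \<open>tl w\<close>,
  which is at least the length of \<open>tl w\<close>; the extra 1 pays for the head letter. So deep
  nodes cannot have both ends in a bounded set.\<close>

lemma length_le_height:
  assumes "w \<noteq> []"
  shows "int (length w) \<le> height (lft w) + height (rgt w) + 1"
proof -
  have "height (lft w) = fst (sb (tl w) (0, 1)) + snd (sb (tl w) (0, 1))"
    using height_vertex_of[OF farey_vec_props(2,1), of "(0, 1)" w] assms sb_nonneg[of "(0, 1)" "tl w"]
    by (auto simp: lft_def farey_vec_def)
  moreover have "height (rgt w) = fst (sb (tl w) (1, 0)) + snd (sb (tl w) (1, 0))"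
    using height_vertex_of[OF farey_vec_props(2,1), of "(1, 0)" w] assms sb_nonneg[of "(1, 0)" "tl w"]
    by (auto simp: rgt_def farey_vec_def)
  ultimately show ?thesis
    using sb_mediant[of "tl w"] sb_mediant_size[of "tl w"] assms by (cases w) auto
qed

section \<open>Every edge and every vertex occurs in the tree\<close>

lemma pos_edge:
  assumes "fst v \<ge> 0" "snd v \<ge> 0" "fst w \<ge> 0" "snd w \<ge> 0" "vdet w v = 1"
  shows "\<exists>t. t \<noteq> [] \<and> lft t = vertex_of v \<and> rgt t = vertex_of w"
proof -
  from sb_surj_edges[of "fst v" "snd v" "fst w" "snd w"] assms obtain t where
    "sb t (0, 1) = v" "sb t (1, 0) = w" by (auto simp: vdet_def algebra_simps)
  then show ?thesis by (intro exI[of _ "True # t"]) (simp add: lft_def rgt_def farey_vec_def)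
qed

lemma neg_edge:
  assumes "fst v \<le> 0" "snd v \<ge> 0" "fst w \<le> 0" "snd w \<ge> 0" "vdet w v = 1"
  shows "\<exists>t. t \<noteq> [] \<and> lft t = vertex_of v \<and> rgt t = vertex_of w"
proof -
  \<comment> \<open>The inverse quarter turn moves both vectors into the positive half.\<close>
  from sb_surj_edges[of "snd v" "- fst v" "snd w" "- fst w"] assms obtain t where
    "sb t (0, 1) = (snd v, - fst v)" "sb t (1, 0) = (snd w, - fst w)" by (auto simp: vdet_def algebra_simps)
  then show ?thesis by (intro exI[of _ "False # t"]) (simp add: lft_def rgt_def farey_vec_def)
qed

text \<open>Two ends in the same closed half are handled by the positive tree or its rotation.
  Strictly opposite signs occur only between a negative integer and \<open>\<infinity>\<close>, and
  writing \<open>\<infinity>\<close> as \<open>(-1, 0)\<close> puts that edge into the negative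
  half.\<close>

lemma edge_word:
  assumes "adj Farey x y"
  shows "\<exists>t. t \<noteq> [] \<and> (lft t = x \<and> rgt t = y \<or> lft t = y \<and> rgt t = x)"
proof -
  have main: "\<exists>t. t \<noteq> [] \<and> (lft t = x \<and> rgt t = y \<or> lft t = y \<and> rgt t = x)"
    if "adj Farey x y" "fst (frac x) \<le> fst (frac y)" for x y
  proof -
    obtain a b c d where f: "frac x = (a, b)" "frac y = (c, d)" by (metis surj_pair)
    have nn: "b \<ge> 0" "d \<ge> 0" "b = 0 \<Longrightarrow> a = 1" "d = 0 \<Longrightarrow> c = 1"
      using frac_props[of x] frac_props[of y] by (auto simp: f)
    have vx: "x = vertex_of (a, b)" "y = vertex_of (c, d)"
      by (metis f vertex_of_frac)+
    have inf: "vertex_of (-1, 0) = vertex_of (1, 0)" by (simp add: vertex_of_def)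
    have det: "vdet (a, b) (c, d) = 1 \<or> vdet (c, d) (a, b) = 1"
      using that(1) by (auto simp: adj_Farey_iff f vdet_def algebra_simps)
    have "a \<le> c" using that(2) by (simp add: f)
    then consider "a \<ge> 0" "c \<ge> 0" | "a \<le> 0" "c \<le> 0" | "a < 0" "c > 0" by linarith
    then show ?thesis
    proof cases
      case 1
      then show ?thesis
        using det pos_edge[of "(a, b)" "(c, d)"] pos_edge[of "(c, d)" "(a, b)"] nn vx by auto
    next
      case 2
      then show ?thesis
        using det neg_edge[of "(a, b)" "(c, d)"] neg_edge[of "(c, d)" "(a, b)"] nn vx by auto
    next
      case 3
      with nn have "b \<ge> 1" by (cases "b = 0") auto
      have "1 * 1 \<le> b * c" using 3 \<open>b \<ge> 1\<close> by (intro mult_mono) auto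
      moreover have "a * d \<le> 0" using 3 nn by (simp add: mult_nonpos_nonneg)
      ultimately have "b * c = 1" "a * d = 0" using det by (auto simp: vdet_def algebra_simps)
      with 3 \<open>b \<ge> 1\<close> have "d = 0" "c = 1" "b = 1" by (auto simp: zmult_eq_1_iff)
      then show ?thesis
        using 3 neg_edge[of "(-1, 0)" "(a, b)"] vx inf by (auto simp: vdet_def)
    qed
  qed
  show ?thesis
  proof (cases "fst (frac x) \<le> fst (frac y)")
    case True
    with main assms show ?thesis by blast
  next
    case False
    with main[of y x] adj_sym[OF assms] show ?thesis by auto
  qed
qed

lemma Farey_neighbour: "\<exists>y. adj Farey x y"
proof -
  obtain a b where f: "frac x = (a, b)" by force
  have cop: "coprime a b" using frac_props(1)[of x] by (simp add: f)
  then obtain u v where uv: "u * a + v * b = 1" by (metis bezout_int coprime_iff_gcd_eq_1)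
  \<comment> \<open>The Bezout coefficients give a vector of determinant 1 with
    \<open>(a, b)\<close>; the sign is chosen to make its second coordinate nonnegative.\<close>
  define w where "w = (if u \<ge> 0 then (- v, u) else (v, - u))"
  have "\<bar>vdet (a, b) w\<bar> = 1" using uv by (auto simp: vdet_def w_def algebra_simps)
  moreover have "coprime (fst w) (snd w)"
  proof -
    have "coprime v u"
      by (rule coprimeI) (metis dvd_add dvd_mult2 uv)
    then show ?thesis by (auto simp: w_def)
  qed
  moreover have "snd w \<ge> 0" by (auto simp: w_def)
  ultimately have "\<bar>vdet (frac (vertex_of (a, b))) (frac (vertex_of w))\<bar> = 1"
    using cop frac_props(2)[of x] by (subst abs_vdet_vertex_of) (auto simp: f)
  then show ?thesis by (metis adj_Farey_iff vertex_of_frac f)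
qed

lemma vertex_word: "\<exists>t. t \<noteq> [] \<and> (lft t = x \<or> rgt t = x)"
  using Farey_neighbour[of x] edge_word by blast

section \<open>Infinite edge-connectivity of the Farey graph\<close>

lemma adj_delete_edges: "adj (delete_edges G F) x y \<longleftrightarrow> adj_avoiding G F x y"
  by (auto simp: adj_def delete_edges_def edges_def)

lemma verts_delete_edges [simp]: "verts (delete_edges G F) = verts G"
  by (simp add: verts_def delete_edges_def)

lemma inf_edge_connected_Farey: "inf_edge_connected Farey"
proof -
  have "conn_in (delete_edges Farey F) UNIV" if F: "finite F" "F \<subseteq> edges Farey" for F
  proof -
    let ?R = "reach_in (delete_edges Farey F) UNIV"
    have "finite (\<Union> F)" using F wf_graph_Farey by (fastforce simp: wf_graph_def)
    then obtain K where K: "\<And>x. x \<in> \<Union> F \<Longrightarrow> height x \<le> K"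
      using finite_imageI[of "\<Union> F" height] by (metis bdd_above.unfold bdd_above_finite image_eqI)
    \<comment> \<open>From this depth on, one end has height above \<open>K\<close>, so the edge
      between the ends is not in \<open>F\<close>.\<close>
    define N where "N = nat (2 * K + 2)"
    \<comment> \<open>Induction from depth \<open>N\<close> back up to the root: the edge of a
      shallower node is replaced by the connections of its two children, which meet at the
      mediant.\<close>
    have ends: "?R (lft w) (rgt w)" if "w \<noteq> []" for w
      using that
    proof (induction "N - length w" arbitrary: w rule: less_induct)
      case less
      show ?case
      proof (cases "length w < N")
        case True
        then have "?R (lft (w @ [False])) (rgt (w @ [False]))" "?R (lft (w @ [True])) (rgt (w @ [True]))"
          using True by (auto intro!: less.hyps simp del: ends_snoc)
        then show ?thesis by simp (rule reach_in_trans)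
      next
        case False
        have "{lft w, rgt w} \<notin> F"
        proof
          assume "{lft w, rgt w} \<in> F"
          with K have "height (lft w) \<le> K" "height (rgt w) \<le> K" by blast+
          with length_le_height[OF less.prems] False show False by (simp add: N_def)
        qed
        with adj_ends[OF less.prems] show ?thesis
          by (intro reach_in_step) (auto simp: adj_delete_edges)
      qed
    qed
    \<comment> \<open>Now downwards from the root, where both ends are \<open>\<infinity>\<close>: a
      child keeps one end of its parent, and \<open>ends\<close> links its new end to that
      one.\<close>
    have "?R (lft w) None \<and> ?R (rgt w) None" for w
    proof (induction w rule: rev_induct)
      case (snoc b w)
      with ends[of "w @ [b]"] show ?case
        by (cases b) (auto intro: reach_in_trans reach_in_sym)
    qed simp
    with vertex_word show ?thesis by (metis conn_in_star)
  qed
  then show ?thesis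
    unfolding inf_edge_connected_def by (auto simp: graph_connected_iff)
qed

section \<open>Independent paths in the Farey graph\<close>

text \<open>On a path from \<open>x\<close> to \<open>y\<close> other than the edge itself, the
  first vertex where \<open>f\<close> is not positive is an interior zero of \<open>f\<close>.
  Independent paths use different zeros.\<close>

lemma finite_indep_paths_if_sign_change:
  fixes f :: "'a \<Rightarrow> int"
  assumes xy: "f x > 0" "f y < 0" and fin: "finite {z. f z = 0}"
    and cross: "\<And>v w. adj G v w \<Longrightarrow> f v > 0 \<Longrightarrow> f w < 0 \<Longrightarrow> v = x \<and> w = y"
    and P: "\<And>p. p \<in> P \<Longrightarrow> path_between G x y p"
    and disj: "\<And>p q. p \<in> P \<Longrightarrow> q \<in> P \<Longrightarrow> p \<noteq> q \<Longrightarrow> inner_verts p \<inter> inner_verts q = {}"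
  shows "finite P"
proof -
  have hit: "\<exists>z. z \<in> inner_verts p \<and> f z = 0" if "p \<in> P" "p \<noteq> [x, y]" for p
  proof -
    from P[OF that(1)] have p: "p \<noteq> []" "distinct p" "successively (adj G) p" "hd p = x" "last p = y"
      by (auto simp: path_between_def is_path_iff)
    have "x \<noteq> y" using xy by auto
    have "\<exists>z\<in>set p. \<not> f z > 0" using p xy by (intro bexI[of _ y]) auto
    then obtain as z bs where z: "p = as @ z # bs" "\<not> f z > 0" "\<forall>v\<in>set as. \<not> \<not> f v > 0"
      by (rule split_list_first_propE)
    have "as \<noteq> []" using z p xy by auto
    have "z \<in> inner_verts p" if "f z = 0"
    proof -
      have "bs \<noteq> []" using that z(1) p xy by auto
      with \<open>as \<noteq> []\<close> show ?thesis
        unfolding z(1) inner_verts_def by (simp add: butlast_append)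
    qed
    moreover have "f z = 0"
    proof (rule ccontr)
      assume "f z \<noteq> 0"
      with z(2) have "f z < 0" by simp
      \<comment> \<open>This edge would change sign, so it is \<open>x\<close>-\<open>y\<close>; as
        the path repeats no vertex, it is just \<open>[x, y]\<close>.\<close>
      have "adj G (last as) z" using p(3) \<open>as \<noteq> []\<close> unfolding z(1) successively_append_iff by simp
      from cross[OF this _ \<open>f z < 0\<close>] z(3) \<open>as \<noteq> []\<close> have "last as = x" "z = y" by auto
      moreover from this have "as = [x]"
        using p(2,4) \<open>as \<noteq> []\<close> unfolding z(1)
        by (cases as rule: rev_cases) (auto simp: hd_append neq_Nil_conv split: if_splits)
      moreover have "bs = []"
        using p(2,5) \<open>z = y\<close> unfolding z(1) by (cases bs rule: rev_cases) auto
      ultimately show False using \<open>p \<noteq> [x, y]\<close> z(1) by simp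
    qed
    ultimately show ?thesis by blast
  qed
  then obtain g where g: "\<And>p. p \<in> P \<Longrightarrow> p \<noteq> [x, y] \<Longrightarrow> g p \<in> inner_verts p \<and> f (g p) = 0"
    by metis
  have "inj_on g (P - {[x, y]})"
    using g disj by (intro inj_onI) (metis DiffD1 DiffD2 disjoint_iff singletonI)
  moreover have "g ` (P - {[x, y]}) \<subseteq> {z. f z = 0}" using g by auto
  ultimately have "finite (P - {[x, y]})" using fin by (meson finite_imageD finite_subset)
  then show ?thesis by simp
qed

section \<open>Primitive vectors and determinants\<close>

lemma coprime_det_0:
  fixes a b c d :: int
  assumes "a * d = b * c" "coprime a b" "coprime c d"
  shows "(a, b) = (c, d) \<or> (a, b) = (- c, - d)"
proof -
  have "a dvd c" "c dvd a" "b dvd d" "d dvd b"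
    using assms by (metis coprime_dvd_mult_right_iff coprime_dvd_mult_left_iff coprime_commute dvd_triv_left dvd_triv_right)+
  then have "\<bar>a\<bar> = \<bar>c\<bar>" "\<bar>b\<bar> = \<bar>d\<bar>" by (auto intro: zdvd_antisym_abs)
  with assms show ?thesis by (auto simp: abs_eq_iff)
qed

text \<open>Rewrites the determinant of an edge in terms of the coordinates of its ends relative to
  \<open>s\<close> and \<open>t\<close>.\<close>

lemma vdet_Pluecker: "vdet s t * vdet v w = vdet v t * vdet s w - vdet s v * vdet w t"
  by (simp add: vdet_def algebra_simps)

lemma vdet_commute: "vdet v w = - vdet w v"
  by (simp add: vdet_def)

lemma vdet_self [simp]: "vdet v v = 0"
  by (simp add: vdet_def)

lemma vdet_coprime:
  assumes "\<bar>vdet v w\<bar> = 1"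
  shows "coprime (fst v) (snd v)" "coprime (fst w) (snd w)"
proof -
  have *: "is_unit c" if "c dvd vdet v w" for c
    using that assms by (metis dvd_abs_iff)
  show "coprime (fst v) (snd v)" "coprime (fst w) (snd w)"
    by (rule coprimeI; rule *; simp add: vdet_def)+
qed

lemma vdet_frac_0:
  assumes "vdet (frac x) v = 0" "coprime (fst v) (snd v)"
  shows "frac x \<in> {v, (- fst v, - snd v)}"
  using coprime_det_0[of "fst (frac x)" "snd v" "snd (frac x)" "fst v"] assms frac_props(1)[of x]
  by (auto simp: vdet_def prod_eq_iff)

lemma vdet_frac_eq_0_iff: "vdet (frac x) (frac y) = 0 \<longleftrightarrow> x = y"
proof
  assume "vdet (frac x) (frac y) = 0"
  then have "frac x \<in> {frac y, (- fst (frac y), - snd (frac y))}"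
    by (rule vdet_frac_0) (rule frac_props)
  then have "vertex_of (frac x) = vertex_of (frac y)"
    by (auto simp: vertex_of_def)
  then show "x = y" by (simp add: vertex_of_frac)
qed simp

lemma finite_frac_vimage: "finite A \<Longrightarrow> finite {z. frac z \<in> A}"
  using finite_vimageI[OF _ inj_frac, of A] by (simp add: vimage_def)

text \<open>The vectors of \<open>x\<close> and \<open>y\<close> form a basis of the integer
  lattice, and \<open>i\<close>, \<open>j\<close> are the coordinates up to the common sign
  \<open>e\<close>. The form compares which coordinate dominates.\<close>

lemma separating_sign_adjacent:
  assumes "adj Farey x y"
  shows "\<exists>f :: rat option \<Rightarrow> int. f x > 0 \<and> f y < 0 \<and> finite {z. f z = 0} \<and>
    (\<forall>v w. adj Farey v w \<longrightarrow> f v > 0 \<longrightarrow> f w < 0 \<longrightarrow> v = x \<and> w = y)"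
proof -
  define e where "e = vdet (frac x) (frac y)"
  have e: "\<bar>e\<bar> = 1" using assms by (simp add: e_def adj_Farey_iff)
  then have ee: "e * e = 1" by (metis abs_mult_self_eq mult_1)
  define i where "i v = vdet (frac v) (frac y)" for v
  define j where "j v = vdet (frac x) (frac v)" for v
  define f where "f v = (i v)\<^sup>2 - (j v)\<^sup>2" for v
  have "f x > 0" "f y < 0"
    using e by (auto simp: f_def i_def j_def simp flip: e_def)
  moreover have "v = x \<and> w = y" if "adj Farey v w" "f v > 0" "f w < 0" for v w
  proof -
    have 1: "\<bar>i v * j w - j v * i w\<bar> = 1"
    proof -
      have "i v * j w - j v * i w = e * vdet (frac v) (frac w)"
        unfolding e_def i_def j_def by (rule vdet_Pluecker[symmetric])
      then show ?thesis using that(1) e by (simp add: abs_mult adj_Farey_iff)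
    qed
    have "\<bar>j v\<bar> < \<bar>i v\<bar>" "\<bar>i w\<bar> < \<bar>j w\<bar>"
      using that(2,3) abs_le_square_iff[of "i v" "j v"] abs_le_square_iff[of "j w" "i w"]
      unfolding f_def by linarith+
    \<comment> \<open>Integrality turns both strict inequalities into a gain of 1. With determinant
      at most 1 in absolute value this leaves no room for a nonzero \<open>j v\<close> or
      \<open>i w\<close>.\<close>
    then have "(\<bar>j v\<bar> + 1) * (\<bar>i w\<bar> + 1) \<le> \<bar>i v\<bar> * \<bar>j w\<bar>" by (intro mult_mono) auto
    then have "\<bar>j v\<bar> * \<bar>i w\<bar> + \<bar>j v\<bar> + \<bar>i w\<bar> + 1 \<le> \<bar>i v * j w\<bar>" by (simp add: abs_mult algebra_simps)
    moreover have "\<bar>i v * j w\<bar> \<le> 1 + \<bar>j v\<bar> * \<bar>i w\<bar>" using 1 by (simp flip: abs_mult)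
    ultimately have "j v = 0" "i w = 0" by auto
    then show ?thesis by (simp add: i_def j_def vdet_frac_eq_0_iff)
  qed
  moreover have "finite {z. f z = 0}"
  proof -
    \<comment> \<open>\<open>h\<close> recovers a vector from its coordinates. At a zero they have
      equal absolute value, which divides a primitive vector and is therefore 1, leaving four sign
      choices.\<close>
    define h where "h = (\<lambda>(i, j). (e * (i * fst (frac x) + j * fst (frac y)), e * (i * snd (frac x) + j * snd (frac y))))"
    have "frac z \<in> h ` ({-1, 1} \<times> {-1, 1})" if "f z = 0" for z
    proof -
      have ij: "\<bar>i z\<bar> = \<bar>j z\<bar>" using that by (simp add: f_def power2_eq_iff abs_eq_iff)
      have "e * fst (frac z) = i z * fst (frac x) + j z * fst (frac y)"
        "e * snd (frac z) = i z * snd (frac x) + j z * snd (frac y)"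
        by (simp_all add: e_def i_def j_def vdet_def algebra_simps)
      then have z: "fst (frac z) = e * (i z * fst (frac x) + j z * fst (frac y))"
        "snd (frac z) = e * (i z * snd (frac x) + j z * snd (frac y))"
        using ee by (metis mult.assoc mult_1)+
      have "i z dvd j z" using ij by (metis dvd_abs_iff dvd_refl)
      then have "i z dvd fst (frac z)" "i z dvd snd (frac z)" unfolding z by auto
      then have "is_unit (i z)" using frac_props(1) coprime_common_divisor by blast
      then have "i z \<in> {-1, 1}" "j z \<in> {-1, 1}" using ij by auto
      moreover have "frac z = h (i z, j z)" using z by (simp add: h_def prod_eq_iff)
      ultimately show ?thesis by blast
    qed
    then have "{z. f z = 0} \<subseteq> {z. frac z \<in> h ` ({-1, 1} \<times> {-1, 1})}" by blast
    then show ?thesis by (rule finite_subset) (rule finite_frac_vimage, simp)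
  qed
  ultimately show ?thesis by blast
qed

text \<open>An edge \<open>s\<close>-\<open>t\<close> separates \<open>x\<close> from
  \<open>y\<close>: \<open>x = t - s\<close> has coordinates of opposite sign, while
  \<open>y = (\<beta> - r) s + r t\<close> has coordinates of equal sign. The form is the product of
  the two coordinates, up to sign, and no edge changes its sign.\<close>

lemma separating_sign_nonadjacent:
  assumes "\<not> adj Farey x y" "x \<noteq> y"
  shows "\<exists>f :: rat option \<Rightarrow> int. f x > 0 \<and> f y < 0 \<and> finite {z. f z = 0} \<and>
    (\<forall>v w. adj Farey v w \<longrightarrow> f v > 0 \<longrightarrow> f w < 0 \<longrightarrow> v = x \<and> w = y)"
proof -
  obtain a b where x: "frac x = (a, b)" by force
  obtain p q where y: "frac y = (p, q)" by force
  obtain d c where "d * a + c * b = 1"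
    using frac_props(1)[of x] by (metis bezout_int coprime_iff_gcd_eq_1 fst_conv snd_conv x)
  then have dc: "a * d + b * c = 1" by (simp add: algebra_simps)
  \<comment> \<open>\<open>(-c, d)\<close> completes \<open>x\<close> to a basis of determinant 1,
    and \<open>y\<close> has coordinates \<open>\<alpha>\<close>, \<open>\<beta>\<close> in
    it.\<close>
  define \<beta> where "\<beta> = vdet (frac x) (frac y)"
  define \<alpha> where "\<alpha> = vdet (frac y) (- c, d)"
  have p: "p = \<alpha> * a - \<beta> * c" and q: "q = \<alpha> * b + \<beta> * d"
    using dc by (simp_all add: \<alpha>_def \<beta>_def vdet_def x y) algebra+
  have "\<beta> \<noteq> 0" "\<bar>\<beta>\<bar> \<noteq> 1"
    using assms by (auto simp: \<beta>_def adj_Farey_iff vdet_frac_eq_0_iff)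
  have "\<not> \<beta> dvd \<alpha>"
  proof
    assume "\<beta> dvd \<alpha>"
    then have "\<beta> dvd p" "\<beta> dvd q" by (auto simp: p q)
    then have "is_unit \<beta>" using frac_props(1)[of y] y coprime_common_divisor by fastforce
    with \<open>\<bar>\<beta>\<bar> \<noteq> 1\<close> show False by simp
  qed
  define n where "n = \<alpha> div \<beta>"
  define r where "r = \<alpha> mod \<beta>"
  have \<alpha>: "\<alpha> = n * \<beta> + r" by (simp add: n_def r_def)
  have "r \<noteq> 0" using \<open>\<not> \<beta> dvd \<alpha>\<close> by (simp add: r_def dvd_eq_mod_eq_0)
  \<comment> \<open>A nonzero remainder has the sign of the divisor \<open>\<beta>\<close> and
    smaller absolute value.\<close>
  have r: "r * (\<beta> - r) > 0"
  proof (cases "\<beta> > 0")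
    case True
    then have "0 < r" "r < \<beta>" using \<open>r \<noteq> 0\<close> pos_mod_bound[of \<beta> \<alpha>] pos_mod_sign[of \<beta> \<alpha>]
      unfolding r_def by linarith+
    then show ?thesis by simp
  next
    case False
    with \<open>\<beta> \<noteq> 0\<close> have "r < 0" "\<beta> < r" using \<open>r \<noteq> 0\<close> neg_mod_bound[of \<beta> \<alpha>] neg_mod_sign[of \<beta> \<alpha>]
      unfolding r_def by linarith+
    then show ?thesis by (simp add: mult_neg_neg)
  qed
  define s where "s = (n * a - c, n * b + d)"
  define t where "t = ((n + 1) * a - c, (n + 1) * b + d)"
  define f where "f v = - (vdet (frac v) t * vdet s (frac v))" for v
  have st: "vdet s t = - 1" unfolding s_def t_def vdet_def fst_conv snd_conv using dc by algebra
  have "vdet (frac x) t = 1" "vdet s (frac x) = - 1"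
    unfolding x s_def t_def vdet_def fst_conv snd_conv using dc by algebra+
  then have "f x > 0" by (simp add: f_def)
  moreover have "vdet (frac y) t = r - \<beta>" "vdet s (frac y) = - r"
    unfolding y s_def t_def vdet_def fst_conv snd_conv p q \<alpha> using dc by algebra+
  then have "f y = - (r * (\<beta> - r))" unfolding f_def by (simp only:) (simp add: algebra_simps)
  with r have "f y < 0" by simp
  moreover have False if "adj Farey v w" "f v > 0" "f w < 0" for v w
  proof -
    define i j k l where "i = vdet (frac v) t" and "j = vdet s (frac v)" and "k = vdet (frac w) t" and "l = vdet s (frac w)"
    have 1: "\<bar>i * l - j * k\<bar> = 1"
      using vdet_Pluecker[of s t "frac v" "frac w"] that(1)
      by (simp add: st i_def j_def k_def l_def adj_Farey_iff)
    have "i * j < 0" "k * l > 0" using that(2,3) by (simp_all add: f_def i_def j_def k_def l_def)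
    \<comment> \<open>Hence \<open>i * l\<close> and \<open>j * k\<close> are nonzero integers of
      opposite sign, so their difference is at least 2 in absolute value.\<close>
    then have "(i * j) * (k * l) < 0" by (rule mult_neg_pos)
    then have "(i * l) * (j * k) < 0" by (simp add: algebra_simps)
    then have "i * l < 0 \<and> j * k > 0 \<or> i * l > 0 \<and> j * k < 0" by (simp add: mult_less_0_iff) blast
    with 1 show False by auto
  qed
  moreover have "finite {z. f z = 0}"
  proof -
    have cop: "coprime (fst s) (snd s)" "coprime (fst t) (snd t)"
      using vdet_coprime[of s t] by (simp_all add: st)
    have "{z. f z = 0} \<subseteq> {z. frac z \<in> {s, (- fst s, - snd s), t, (- fst t, - snd t)}}"
    proof
      fix z assume "z \<in> {z. f z = 0}"
      then have "vdet (frac z) t = 0 \<or> vdet (frac z) s = 0"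
        by (auto simp: f_def vdet_commute[of s])
      then show "z \<in> {z. frac z \<in> {s, (- fst s, - snd s), t, (- fst t, - snd t)}}"
        using vdet_frac_0[OF _ cop(1)] vdet_frac_0[OF _ cop(2)] by blast
    qed
    then show ?thesis by (rule finite_subset) (rule finite_frac_vimage, simp)
  qed
  ultimately show ?thesis by (intro exI[of _ f] conjI allI impI; fast)
qed

lemma not_inf_indep_paths_Farey: "\<not> inf_indep_paths Farey"
proof
  assume "inf_indep_paths Farey"
  then obtain x y P where xy: "x \<noteq> y" "infinite P" "\<forall>p\<in>P. path_between Farey x y p"
    "\<forall>p\<in>P. \<forall>q\<in>P. p \<noteq> q \<longrightarrow> inner_verts p \<inter> inner_verts q = {}"
    unfolding inf_indep_paths_def by (elim bexE exE conjE)
  have "\<exists>f :: rat option \<Rightarrow> int. f x > 0 \<and> f y < 0 \<and> finite {z. f z = 0} \<and>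
    (\<forall>v w. adj Farey v w \<longrightarrow> f v > 0 \<longrightarrow> f w < 0 \<longrightarrow> v = x \<and> w = y)"
    by (cases "adj Farey x y") (simp_all only: separating_sign_adjacent separating_sign_nonadjacent xy(1) not_False_eq_True)
  then obtain f :: "rat option \<Rightarrow> int" where f: "f x > 0" "f y < 0" "finite {z. f z = 0}"
    "\<forall>v w. adj Farey v w \<longrightarrow> f v > 0 \<longrightarrow> f w < 0 \<longrightarrow> v = x \<and> w = y" by (elim exE conjE)
  have "finite P"
    using f(1-3) f(4)[rule_format] xy(3,4)[rule_format] by (rule finite_indep_paths_if_sign_change)
  with xy(2) show False by simp
qed

lemma Pi_graph_Farey: "Pi_graph Farey"
  by (simp add: Pi_graph_def wf_graph_Farey inf_edge_connected_Farey not_inf_indep_paths_Farey)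

section \<open>The Farey graph as a minor\<close>

text \<open>Indexed by the same words as the Farey intervals: the corridor at \<open>w\<close>
  realises the interval from \<open>lft w\<close> to \<open>rgt w\<close>.\<close>

locale corridor_tree =
  fixes G :: "'a graph" and U V X :: "bool list \<Rightarrow> 'a set"
  assumes corridor: "corridor G (U w) (V w) (X w)"
    and splits: "splits G (U w, V w, X w) (U (w @ [False]), V (w @ [False]), X (w @ [False]))
      (U (w @ [True]), V (w @ [True]), X (w @ [True]))"
begin

text \<open>At the root both \<open>U []\<close> and \<open>V []\<close> are pieces of
  \<open>None\<close>; this is where the two end sets are merged.\<close>

definition is_end :: "bool list \<Rightarrow> rat option \<Rightarrow> 'a set \<Rightarrow> bool" where
  "is_end w q A \<longleftrightarrow> A = U w \<and> q = lft w \<or> A = V w \<and> q = rgt w"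

definition branch :: "rat option \<Rightarrow> 'a set" where
  "branch q = \<Union> {A. \<exists>w. is_end w q A}"

lemma corridor_props:
  "U w \<subseteq> verts G" "V w \<subseteq> verts G" "U w \<inter> V w = {}" "U w \<inter> X w = {}" "V w \<inter> X w = {}"
  "U w \<noteq> {}" "V w \<noteq> {}" "conn_in G (U w)" "conn_in G (V w)"
  using corridor[of w] by (simp_all add: corridor_def)

lemma split_props:
  "U w \<subseteq> U (w @ [False])" "U (w @ [False]) \<subseteq> U w \<union> X w" "V (w @ [True]) = V w"
  "V (w @ [False]) = U (w @ [True])" "U (w @ [True]) \<subseteq> X w"
  "X (w @ [False]) \<subseteq> X w" "X (w @ [True]) \<subseteq> X w" "X (w @ [False]) \<inter> X (w @ [True]) = {}"
  "U (w @ [False]) \<inter> X (w @ [True]) = {}" "\<exists>u\<in>U (w @ [False]). \<exists>v\<in>V w. adj G u v"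
  using splits[of w] by (auto simp: splits_def)

lemma X_snoc: "X (w @ [b]) \<subseteq> X w"
  using split_props(6,7) by (cases b) auto

lemma is_end_snoc:
  assumes "is_end (w @ [b]) q A"
  obtains A0 where "is_end w q A0" "A \<subseteq> A0 \<union> X w" | "q = mid w" "A = U (w @ [True])"
proof (cases b)
  case True
  with assms consider "A = U (w @ [True])" "q = mid w" | "A = V w" "q = rgt w"
    by (auto simp: is_end_def split_props(3))
  then show ?thesis
    by cases (use that in \<open>auto simp: is_end_def\<close>)
next
  case False
  with assms consider "A = U (w @ [False])" "q = lft w" | "A = U (w @ [True])" "q = mid w"
    by (auto simp: is_end_def split_props(4))
  then show ?thesis
    by cases (use that split_props(2)[of w] in \<open>auto simp: is_end_def\<close>)
qed

text \<open>A piece survives in the leftmost or rightmost child. This lifts two pieces from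
  different depths to a common level.\<close>

lemma end_growth:
  assumes "is_end w q A"
  shows "\<exists>w' A'. length w' = length w + k \<and> is_end w' q A' \<and> A \<subseteq> A'"
proof (induction k)
  case 0
  with assms show ?case by auto
next
  case (Suc k)
  then obtain w' A' where w': "length w' = length w + k" "is_end w' q A'" "A \<subseteq> A'" by blast
  then consider "A' = U w'" "q = lft w'" | "A' = V w'" "q = rgt w'" by (auto simp: is_end_def)
  then show ?case
  proof cases
    case 1
    then show ?thesis
      using w' split_props(1)[of w'] by (intro exI[of _ "w' @ [False]"] exI[of _ "U (w' @ [False])"]) (auto simp: is_end_def)
  next
    case 2
    then show ?thesis
      using w' split_props(3)[of w'] by (intro exI[of _ "w' @ [True]"] exI[of _ "V (w' @ [True])"]) (auto simp: is_end_def)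
  qed
qed

text \<open>Pieces grow into territories, so disjointness of pieces and of territories must be
  proved together. Comparing only nodes of equal depth keeps a piece apart from the territory of its
  own ancestors.\<close>

lemma level_disjoint:
  assumes "length v = length w"
  shows "(\<forall>q A q' A'. is_end v q A \<longrightarrow> is_end w q' A' \<longrightarrow> q \<noteq> q' \<longrightarrow> A \<inter> A' = {}) \<and>
    (v \<noteq> w \<longrightarrow> X v \<inter> X w = {} \<and> (\<forall>q A. is_end v q A \<longrightarrow> A \<inter> X w = {}) \<and> (\<forall>q A. is_end w q A \<longrightarrow> A \<inter> X v = {}))"
  using assms
proof (induction v arbitrary: w rule: rev_induct)
  case Nil
  \<comment> \<open>Vacuous: the only word is the root, whose two ends are the same vertex.\<close>
  then show ?case by (auto simp: is_end_def)
next
  case (snoc b v)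
  then obtain w' c where w: "w = w' @ [c]" "length v = length w'"
    by (cases w rule: rev_cases) auto
  note IH = snoc.IH[OF w(2)]
  show ?case
  proof (cases "v = w'")
    case True
    \<comment> \<open>Same parent: everything follows from the splitting of that one
      corridor.\<close>
    note sp = split_props(3,4)[of v]
    have "U (v @ [False]) \<inter> U (v @ [True]) = {}" "U (v @ [True]) \<inter> X (v @ [False]) = {}"
      using corridor_props(3,5)[of "v @ [False]"] by (simp_all add: sp)
    moreover have "U (v @ [False]) \<inter> V v = {}"
      using split_props(2)[of v] corridor_props(3,5)[of v] by blast
    moreover have "U (v @ [True]) \<inter> V v = {}"
      using split_props(5)[of v] corridor_props(5)[of v] by blast
    moreover have "V v \<inter> X (v @ [False]) = {}"
      using split_props(6)[of v] corridor_props(5)[of v] by blast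
    ultimately have sep: "U (v @ [False]) \<inter> U (v @ [True]) = {}" "U (v @ [True]) \<inter> X (v @ [False]) = {}"
      "U (v @ [False]) \<inter> V v = {}" "U (v @ [True]) \<inter> V v = {}" "V v \<inter> X (v @ [False]) = {}"
      "X (v @ [False]) \<inter> X (v @ [True]) = {}" "U (v @ [False]) \<inter> X (v @ [True]) = {}"
      using split_props(8,9)[of v] by simp_all
    have AA: "A \<inter> A' = {}" if "is_end (v @ [b]) q A" "is_end (v @ [c]) q' A'" "q \<noteq> q'" for q A q' A'
      using that sep[unfolded disjoint_iff] by (cases b; cases c) (auto simp: is_end_def sp)
    have AX: "A \<inter> X (v @ [\<not> b]) = {}" if "is_end (v @ [b]) q A" for b q A
      using that sep corridor_props(4)[of "v @ [True]"] by (cases b) (auto simp: is_end_def sp)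
    have XX: "X (v @ [b]) \<inter> X (v @ [\<not> b]) = {}" for b
      by (cases b) (simp_all add: sep Int_commute)
    show ?thesis
    proof (cases "b = c")
      case bc: True
      show ?thesis
        unfolding w(1) True[symmetric] by (intro conjI allI impI) (erule (2) AA, simp_all add: bc)
    next
      case False
      then have c: "c = (\<not> b)" by auto
      from AX[of "\<not> b"] have cb: "\<And>q A. is_end (v @ [c]) q A \<Longrightarrow> A \<inter> X (v @ [b]) = {}"
        by (simp add: c)
      from AX[of b] have bc: "\<And>q A. is_end (v @ [b]) q A \<Longrightarrow> A \<inter> X (v @ [c]) = {}"
        by (simp add: c)
      from XX[of b] have Xbc: "X (v @ [b]) \<inter> X (v @ [c]) = {}" by (simp add: c)
      show ?thesis
        unfolding w(1) True[symmetric]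
        by (intro conjI allI impI) (erule (2) AA, rule Xbc, erule bc, erule cb)
    qed
  next
    case False
    \<comment> \<open>Different parents: whatever is new lies in the territory of its own parent,
      which by induction is disjoint from the other parent's territory and ends.\<close>
    note Xs = X_snoc[of v b] X_snoc[of w' c]
    note IH1 = IH[THEN conjunct1, rule_format]
    have XX: "X v \<inter> X w' = {}" using IH False by simp
    have IH2: "A \<inter> X w' = {}" if "is_end v q A" for q A
      using IH False that by simp
    have IH3: "A \<inter> X v = {}" if "is_end w' q A" for q A
      using IH False that by simp
    have v_w: "A \<inter> X w' = {}" if "is_end (v @ [b]) q A" for q A
      using that
    proof (cases rule: is_end_snoc)
      case (1 A0)
      with IH2[OF 1(1)] XX show ?thesis by blast
    next
      case 2
      with split_props(5)[of v] XX show ?thesis by blast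
    qed
    have w_v: "A \<inter> X v = {}" if "is_end (w' @ [c]) q A" for q A
      using that
    proof (cases rule: is_end_snoc)
      case (1 A0)
      with IH3[OF 1(1)] XX show ?thesis by blast
    next
      case 2
      with split_props(5)[of w'] XX show ?thesis by blast
    qed
    have AA: "A \<inter> A' = {}" if e: "is_end (v @ [b]) q A" "is_end (w' @ [c]) q' A'" "q \<noteq> q'" for q A q' A'
      using e(1)
    proof (cases rule: is_end_snoc)
      case A: (1 A0)
      show ?thesis using e(2)
      proof (cases rule: is_end_snoc)
        case (1 A0')
        have "A0 \<inter> A0' = {}" using A(1) 1(1) e(3) by (rule IH1)
        with A 1 show ?thesis using v_w[OF e(1)] w_v[OF e(2)] by blast
      next
        case 2
        with split_props(5)[of w'] v_w[OF e(1)] show ?thesis by blast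
      qed
    next
      case 2
      with split_props(5)[of v] w_v[OF e(2)] show ?thesis by blast
    qed
    have Xb: "X (v @ [b]) \<inter> X (w' @ [c]) = {}" using Xs XX by blast
    have vb: "A \<inter> X (w' @ [c]) = {}" if "is_end (v @ [b]) q A" for q A
      using v_w[OF that] Xs by blast
    have wb: "A \<inter> X (v @ [b]) = {}" if "is_end (w' @ [c]) q A" for q A
      using w_v[OF that] Xs by blast
    show ?thesis
      unfolding w(1) by (intro conjI allI impI) (erule (2) AA, rule Xb, erule vb, erule wb)
  qed
qed

lemma branch_disjoint:
  assumes "q \<noteq> q'"
  shows "branch q \<inter> branch q' = {}"
proof (rule ccontr)
  assume "\<not> ?thesis"
  then obtain x v w A A' where *: "x \<in> A" "x \<in> A'" "is_end v q A" "is_end w q' A'"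
    by (auto simp: branch_def)
  from end_growth[OF *(3), of "length w"] obtain v' B where
    v': "length v' = length v + length w" "is_end v' q B" "A \<subseteq> B" by blast
  from end_growth[OF *(4), of "length v"] obtain w' B' where
    w': "length w' = length w + length v" "is_end w' q' B'" "A' \<subseteq> B'" by blast
  from level_disjoint[of v' w'] v' w' assms have "B \<inter> B' = {}" by auto
  with * v' w' show False by blast
qed

section \<open>Connectedness of the branch sets and the minor\<close>

lemma ends_subset_branch: "U w \<subseteq> branch (lft w)" "V w \<subseteq> branch (rgt w)"
  by (auto simp: branch_def is_end_def)

lemma branch_conn: "conn_in G (branch q)"
proof -
  \<comment> \<open>An anchor in the piece with which \<open>q\<close> first appears: the root set
    for \<open>\<infinity>\<close>, otherwise the middle set at the node whose mediant is
    \<open>q\<close>. Every later piece is joined to it.\<close>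
  define c where "c q = (SOME x. x \<in> (if q = None then U [] else U (inv mid q @ [True])))" for q
  have c_None: "c None \<in> U []"
    unfolding c_def using corridor_props(6)[of "[]"] by (auto intro: someI)
  have c_mid: "c (mid w) \<in> U (w @ [True])" for w
    unfolding c_def using corridor_props(6)[of "w @ [True]"] mid_neq_None[of w] inv_f_f[OF inj_mid]
    by (auto intro: someI)
  have "(\<forall>x\<in>U w. reach_in G (branch (lft w)) x (c (lft w))) \<and>
    (\<forall>x\<in>V w. reach_in G (branch (rgt w)) x (c (rgt w)))" for w
  proof (induction w rule: rev_induct)
    case Nil
    have sub: "U [False] \<subseteq> branch None" "V [] \<subseteq> branch None" "U [] \<subseteq> U [False]"
      using ends_subset_branch(1)[of "[False]"] ends_subset_branch(2)[of "[]"] split_props(1)[of "[]"]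
        ends_snoc(1)[of "[]"] by auto
    \<comment> \<open>The edge produced by splitting the root corridor bridges the two merged root
      sets.\<close>
    obtain u v where uv: "u \<in> U [False]" "v \<in> V []" "adj G u v"
      using split_props(10)[of "[]"] by auto
    have 1: "reach_in G (branch None) x (c None)" if "x \<in> U [False]" for x
      using corridor_props(8)[of "[False]"] that c_None sub by (blast intro: conn_in_reach)
    have "reach_in G (branch None) x (c None)" if "x \<in> V []" for x
    proof -
      have "reach_in G (branch None) x v"
        using corridor_props(9)[of "[]"] that uv sub by (blast intro: conn_in_reach)
      moreover have "reach_in G (branch None) v u"
        using uv sub by (intro reach_in_step adj_sym[of G u v]) auto
      ultimately show ?thesis using 1[OF uv(1)] reach_in_trans by metis
    qed
    with 1 sub show ?case by auto
  next
    case (snoc b w)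
    have mid: "\<forall>x\<in>U (w @ [True]). reach_in G (branch (mid w)) x (c (mid w))"
      using corridor_props(8)[of "w @ [True]"] c_mid[of w] ends_subset_branch(1)[of "w @ [True]"]
      by (auto intro: conn_in_reach)
    show ?case
    proof (cases b)
      case True
      with mid snoc.IH split_props(3)[of w] show ?thesis by simp
    next
      case False
      obtain u where u: "u \<in> U w" using corridor_props(6) by blast
      have "reach_in G (branch (lft w)) x (c (lft w))" if "x \<in> U (w @ [False])" for x
      proof -
        have "reach_in G (branch (lft w)) x u"
          using corridor_props(8)[of "w @ [False]"] that u split_props(1)[of w] ends_subset_branch(1)[of "w @ [False]"]
          by (auto intro: conn_in_reach)
        with snoc.IH u show ?thesis using reach_in_trans by metis
      qed
      with False mid split_props(4)[of w] show ?thesis by simp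
    qed
  qed
  then show ?thesis
    by (intro conn_in_star[where c = "c q"]) (auto simp: branch_def is_end_def)
qed

lemma Farey_minor: "is_minor Farey G"
  unfolding is_minor_def
proof (intro exI[of _ branch] conjI ballI impI)
  fix h h' :: "rat option"
  show "branch h \<noteq> {}"
    using vertex_word[of h] ends_subset_branch corridor_props(6,7) by blast
  show "branch h \<subseteq> verts G"
    using corridor_props(1,2) by (auto simp: branch_def is_end_def)
  show "graph_connected (induced G (branch h))"
    by (simp add: graph_connected_induced_iff branch_conn)
  show "branch h \<inter> branch h' = {}" if "h \<noteq> h'"
    using that by (rule branch_disjoint)
  show "\<exists>u\<in>branch h. \<exists>v\<in>branch h'. {u, v} \<in> edges G" if "adj Farey h h'"
  proof -
    from edge_word[OF that] obtain w where w: "lft w = h \<and> rgt w = h' \<or> lft w = h' \<and> rgt w = h" by blast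
    \<comment> \<open>The edge comes from splitting the corridor at \<open>w\<close>; the enlarged
      left set still belongs to \<open>lft w\<close>.\<close>
    obtain u v where uv: "u \<in> U (w @ [False])" "v \<in> V w" "adj G u v"
      using split_props(10)[of w] by blast
    then have "u \<in> branch (lft w)" "v \<in> branch (rgt w)" "{u, v} \<in> edges G"
      using ends_subset_branch(1)[of "w @ [False]"] ends_subset_branch(2)[of w] by (auto simp: adj_def)
    with w show ?thesis by (metis insert_commute)
  qed
qed

end

theorem Farey_minor_of_Pi_graph:
  fixes G :: "'a graph"
  assumes "Pi_graph G"
  shows "is_minor Farey G"
proof -
  have G: "inf_edge_connected G" "\<not> inf_indep_paths G" using assms by (simp_all add: Pi_graph_def)
  define ok where "ok = (\<lambda>(U, V, X). corridor G U V X)"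
  have "\<forall>s. \<exists>l r. ok s \<longrightarrow> ok l \<and> ok r \<and> splits G s l r"
    using corridor_splits[OF G(2)] by (auto simp: ok_def) blast
  then obtain L R where LR: "\<And>s. ok s \<Longrightarrow> ok (L s) \<and> ok (R s) \<and> splits G s (L s) (R s)" by metis
  from G(1) obtain x y where xy: "x \<in> verts G" "y \<in> verts G" "x \<noteq> y"
    unfolding inf_edge_connected_def by blast
  have "linked G {x} {y} (verts G - {x} - {y})"
  proof -
    have "linked G {x} {y} (verts G)" unfolding linked_def
    proof (intro allI impI)
      fix F :: "'a set set" assume "finite F"
      \<comment> \<open>\<open>linked\<close> ranges over arbitrary finite \<open>F\<close>,
        edge-connectivity only over sets of edges.\<close>
      then have "graph_connected (delete_edges G (F \<inter> edges G))"
        using G(1) by (simp add: inf_edge_connected_def)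
      then obtain p where p: "path_between (delete_edges G (F \<inter> edges G)) x y p"
        using xy by (auto simp: graph_connected_def)
      then have "successively (adj (delete_edges G (F \<inter> edges G))) p"
        by (simp add: path_between_def is_path_iff)
      then have w: "successively (adj_avoiding G F) p"
        by (rule successively_mono) (unfold adj_delete_edges, auto simp: adj_def)
      obtain xs where "p = x # xs @ [y]"
        using p xy(3) by (cases p; cases "tl p" rule: rev_cases) (auto simp: path_between_def is_path_iff)
      moreover have "set p \<subseteq> verts G" using p by (simp add: path_between_def is_path_iff)
      ultimately show "\<exists>u\<in>{x}. \<exists>v\<in>{y}. \<exists>xs. set xs \<subseteq> verts G \<and> successively (adj_avoiding G F) (u # xs @ [v])"
        using w by auto
    qed
    then have "linked G {x} {y} (verts G - {x})" by (rule linked_grow_left) simp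
    then show ?thesis by (rule linked_grow_right) simp
  qed
  then have ok0: "ok ({x}, {y}, verts G - {x} - {y})"
    using xy by (auto simp: ok_def corridor_def conn_in_singleton)
  \<comment> \<open>Reading a word from the root with the chosen children \<open>L\<close> and
    \<open>R\<close>; folding from the left makes appending a letter one more subdivision.\<close>
  define st where "st w = foldl (\<lambda>s b. if b then R s else L s) ({x}, {y}, verts G - {x} - {y}) w" for w
  have st_snoc: "st (w @ [b]) = (if b then R (st w) else L (st w))" for w b
    by (simp add: st_def)
  have ok: "ok (st w)" for w
  proof (induction w rule: rev_induct)
    case Nil
    show ?case using ok0 by (simp add: st_def)
  next
    case (snoc b w)
    with LR show ?case by (simp add: st_snoc)
  qed
  interpret corridor_tree G "\<lambda>w. fst (st w)" "\<lambda>w. fst (snd (st w))" "\<lambda>w. snd (snd (st w))"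
  proof
    show "corridor G (fst (st w)) (fst (snd (st w))) (snd (snd (st w)))" for w
      using ok[of w] by (simp add: ok_def case_prod_beta)
    show "splits G (fst (st w), fst (snd (st w)), snd (snd (st w)))
      (fst (st (w @ [False])), fst (snd (st (w @ [False]))), snd (snd (st (w @ [False]))))
      (fst (st (w @ [True])), fst (snd (st (w @ [True]))), snd (snd (st (w @ [True]))))" for w
      using LR[OF ok[of w]] by (simp add: st_snoc)
  qed
  show ?thesis by (rule Farey_minor)
qed

section \<open>Isomorphic copies\<close>

text \<open>Typicality quantifies over graphs on one fixed vertex type, so the Farey graph has to be
  copied into that type.\<close>

definition map_graph :: "('a \<Rightarrow> 'b) \<Rightarrow> 'a graph \<Rightarrow> 'b graph" where
  "map_graph \<phi> G = (\<phi> ` verts G, (`) \<phi> ` edges G)"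

lemma verts_map_graph [simp]: "verts (map_graph \<phi> G) = \<phi> ` verts G"
  and edges_map_graph [simp]: "edges (map_graph \<phi> G) = (`) \<phi> ` edges G"
  by (simp_all add: map_graph_def verts_def edges_def)

lemma edge_map_graph:
  assumes "inj \<phi>"
  shows "{\<phi> x, \<phi> y} \<in> (`) \<phi> ` E \<longleftrightarrow> {x, y} \<in> E"
  using inj_image_eq_iff[OF assms, of "{x, y}"] by (auto simp: image_iff)

lemma adj_map_graph: "inj \<phi> \<Longrightarrow> adj (map_graph \<phi> G) (\<phi> x) (\<phi> y) \<longleftrightarrow> adj G x y"
  by (simp add: adj_def edge_map_graph inj_eq)

lemma path_between_map_graph:
  assumes "inj \<phi>"
  shows "path_between (map_graph \<phi> G) (\<phi> x) (\<phi> y) (map \<phi> p) \<longleftrightarrow> path_between G x y p"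
proof (cases "p = []")
  case True
  then show ?thesis by (simp add: path_between_def is_path_iff)
next
  case False
  then show ?thesis
    using assms
    by (auto simp: path_between_def is_path_iff successively_map adj_map_graph distinct_map inj_on_subset
        hd_map last_map inj_eq inj_image_subset_iff)
qed

lemma path_map_graph_obtain:
  assumes "path_between (map_graph \<phi> G) x y q"
  obtains p where "q = map \<phi> p"
proof -
  have "set q \<subseteq> range \<phi>" using assms by (auto simp: path_between_def is_path_def)
  with that show thesis by (metis ex_map_conv subsetD rangeE)
qed

lemma graph_connected_map_graph:
  assumes "inj \<phi>"
  shows "graph_connected (map_graph \<phi> G) \<longleftrightarrow> graph_connected G"
proof -
  have "(\<exists>q. path_between (map_graph \<phi> G) (\<phi> x) (\<phi> y) q) \<longleftrightarrow> (\<exists>p. path_between G x y p)" for x y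
    using path_between_map_graph[OF assms] path_map_graph_obtain by metis
  then show ?thesis by (simp add: graph_connected_def)
qed

lemma delete_edges_map_graph:
  assumes "inj \<phi>"
  shows "delete_edges (map_graph \<phi> G) ((`) \<phi> ` F) = map_graph \<phi> (delete_edges G F)"
proof -
  have "inj ((`) \<phi>)" using assms by (simp add: inj_on_def inj_image_eq_iff)
  then show ?thesis
    by (simp add: delete_edges_def map_graph_def verts_def edges_def image_set_diff)
qed

lemma induced_map_graph:
  assumes "inj \<phi>"
  shows "induced (map_graph \<phi> G) (\<phi> ` A) = map_graph \<phi> (induced G A)"
  using assms by (auto simp: induced_def map_graph_def verts_def edges_def inj_image_subset_iff)

lemma inf_edge_connected_map_graph:
  assumes "inj \<phi>" "inf_edge_connected G"
  shows "inf_edge_connected (map_graph \<phi> G)"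
proof -
  have "graph_connected (delete_edges (map_graph \<phi> G) F)"
    if "finite F" "F \<subseteq> edges (map_graph \<phi> G)" for F
  proof -
    from that obtain F0 where "F0 \<subseteq> edges G" "finite F0" "F = (`) \<phi> ` F0"
      by (metis edges_map_graph finite_subset_image)
    with assms show ?thesis
      by (simp add: delete_edges_map_graph graph_connected_map_graph inf_edge_connected_def)
  qed
  moreover obtain x y where "x \<in> verts G" "y \<in> verts G" "x \<noteq> y"
    using assms(2) unfolding inf_edge_connected_def by (elim conjE bexE)
  then have "\<exists>x\<in>verts (map_graph \<phi> G). \<exists>y\<in>verts (map_graph \<phi> G). x \<noteq> y"
    using assms(1) by (auto simp: inj_eq)
  ultimately show ?thesis unfolding inf_edge_connected_def by simp
qed

lemma inf_indep_paths_map_graph: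
  assumes "inj \<phi>" "inf_indep_paths (map_graph \<phi> G)"
  shows "inf_indep_paths G"
proof -
  from assms(2) obtain x y P where xy: "x \<in> verts (map_graph \<phi> G)" "y \<in> verts (map_graph \<phi> G)" "x \<noteq> y" "infinite P"
    and P: "\<forall>p\<in>P. path_between (map_graph \<phi> G) x y p"
    and disj: "\<forall>p\<in>P. \<forall>q\<in>P. p \<noteq> q \<longrightarrow> inner_verts p \<inter> inner_verts q = {}"
    unfolding inf_indep_paths_def by (elim bexE exE conjE)
  from xy obtain x' y' where x': "x = \<phi> x'" "y = \<phi> y'" "x' \<in> verts G" "y' \<in> verts G" by auto
  \<comment> \<open>All paths of the copy are images, so \<open>P\<close> lies in the image of
    \<open>Q\<close>, which is therefore infinite.\<close>
  define Q where "Q = {p. map \<phi> p \<in> P}"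
  have "P \<subseteq> map \<phi> ` Q"
  proof
    fix q assume "q \<in> P"
    with P obtain p where "q = map \<phi> p" by (meson path_map_graph_obtain)
    with \<open>q \<in> P\<close> show "q \<in> map \<phi> ` Q" by (auto simp: Q_def)
  qed
  with xy(4) have "infinite Q" by (meson finite_imageI finite_subset)
  moreover have "\<forall>p\<in>Q. path_between G x' y' p"
    using P by (auto simp: Q_def x' path_between_map_graph[OF assms(1)] dest!: bspec)
  moreover have "\<forall>p\<in>Q. \<forall>q\<in>Q. p \<noteq> q \<longrightarrow> inner_verts p \<inter> inner_verts q = {}"
  proof (intro ballI impI)
    fix p q assume "p \<in> Q" "q \<in> Q" "p \<noteq> q"
    then have "inner_verts (map \<phi> p) \<inter> inner_verts (map \<phi> q) = {}"
      using disj assms(1) by (simp add: Q_def inj_map_eq_map)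
    moreover have "inner_verts (map \<phi> r) = \<phi> ` inner_verts r" for r
      by (simp add: inner_verts_def map_tl map_butlast flip: set_map)
    ultimately show "inner_verts p \<inter> inner_verts q = {}" by auto
  qed
  moreover have "x' \<noteq> y'" using xy(3) x' by auto
  ultimately show ?thesis
    unfolding inf_indep_paths_def using x'(3,4) by blast
qed

lemma Pi_graph_map_graph:
  assumes "inj \<phi>" "Pi_graph G"
  shows "Pi_graph (map_graph \<phi> G)"
proof -
  have "wf_graph (map_graph \<phi> G)"
    unfolding wf_graph_def
  proof
    fix e assume "e \<in> edges (map_graph \<phi> G)"
    then obtain e' where "e' \<in> edges G" "e = \<phi> ` e'" by auto
    moreover from this obtain x y where "x \<noteq> y" "x \<in> verts G" "y \<in> verts G" "e' = {x, y}"
      using assms(2) by (auto simp: Pi_graph_def wf_graph_def)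
    ultimately show "\<exists>x y. x \<noteq> y \<and> x \<in> verts (map_graph \<phi> G) \<and> y \<in> verts (map_graph \<phi> G) \<and> e = {x, y}"
      using assms(1) by (intro exI[of _ "\<phi> x"] exI[of _ "\<phi> y"]) (auto simp: inj_eq)
  qed
  with assms show ?thesis
    using inf_indep_paths_map_graph[OF assms(1), of G] by (auto simp: Pi_graph_def inf_edge_connected_map_graph)
qed

text \<open>The preimages of the branch sets serve as branch sets in \<open>G\<close>.\<close>

lemma is_minor_map_graph:
  assumes "inj \<phi>" "is_minor H (map_graph \<phi> G)"
  shows "is_minor H G"
proof -
  from assms(2) obtain B where
    B1: "\<forall>h\<in>verts H. B h \<noteq> {} \<and> B h \<subseteq> verts (map_graph \<phi> G) \<and> graph_connected (induced (map_graph \<phi> G) (B h))"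
    and B2: "\<forall>h\<in>verts H. \<forall>h'\<in>verts H. h \<noteq> h' \<longrightarrow> B h \<inter> B h' = {}"
    and B3: "\<forall>h\<in>verts H. \<forall>h'\<in>verts H. adj H h h' \<longrightarrow> (\<exists>u\<in>B h. \<exists>v\<in>B h'. {u, v} \<in> edges (map_graph \<phi> G))"
    unfolding is_minor_def by (elim exE conjE)
  define C where "C h = \<phi> -` B h" for h
  have BC: "B h = \<phi> ` C h" "C h \<subseteq> verts G" if "h \<in> verts H" for h
    using bspec[OF B1 that] assms(1) by (auto simp: C_def inj_eq)
  show ?thesis
    unfolding is_minor_def
  proof (intro exI[of _ C] conjI ballI impI)
    fix h assume h: "h \<in> verts H"
    show "C h \<subseteq> verts G" using BC[OF h] by simp
    show "C h \<noteq> {}" using bspec[OF B1 h] BC(1)[OF h] by auto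
    show "graph_connected (induced G (C h))"
      using bspec[OF B1 h] BC(1)[OF h] assms(1) by (simp add: induced_map_graph graph_connected_map_graph)
    fix h' assume h': "h' \<in> verts H"
    show "C h \<inter> C h' = {}" if "h \<noteq> h'" using B2 h h' that by (auto simp: C_def)
    show "\<exists>u\<in>C h. \<exists>v\<in>C h'. {u, v} \<in> edges G" if "adj H h h'"
      using B3[rule_format, OF h h' that] assms(1) unfolding BC(1)[OF h] BC(1)[OF h']
      by (auto simp: edge_map_graph)
  qed
qed

theorem theorem1:
  shows "typical_in TYPE('a) Farey \<and>
    (\<forall>H :: 'b graph. infinite (UNIV :: 'c set) \<and> typical_in TYPE('c) H \<longrightarrow> minor_equiv H Farey)"
proof (intro conjI allI impI)
  show "typical_in TYPE('a) Farey"
    by (simp add: typical_in_def Pi_graph_Farey Farey_minor_of_Pi_graph)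
next
  fix H :: "'b graph"
  assume H: "infinite (UNIV :: 'c set) \<and> typical_in TYPE('c) H"
  \<comment> \<open>The Farey graph is countable, so an infinite type has room for a copy;
    \<open>H\<close> is a minor of this copy, hence of the Farey graph.\<close>
  then obtain f :: "nat \<Rightarrow> 'c" where "inj f"
    using infinite_countable_subset by blast
  then have inj: "inj (f \<circ> (to_nat :: rat option \<Rightarrow> nat))"
    by (intro inj_compose) auto
  have "is_minor H (map_graph (f \<circ> to_nat) Farey)"
    using H Pi_graph_map_graph[OF inj Pi_graph_Farey] unfolding typical_in_def by blast
  then have "is_minor H Farey" by (rule is_minor_map_graph[OF inj])
  moreover have "is_minor Farey H"
    using H by (simp add: typical_in_def Farey_minor_of_Pi_graph)
  ultimately show "minor_equiv H Farey" by (simp add: minor_equiv_def)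
qed

end
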